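(* Let $n\ge 1$ and let $A\in\mathbb{C}^{n\times n}$ be similar to an $M$-matrix or to an inverse $M$-matrix. Then the normalized coefficients $c_0(A),\ldots,c_n(A)$ of the characteristic polynomial of $A$ satisfy Newton's inequalities $$c_j(A)^2\ \ge\ c_{j-1}(A)\,c_{j+1}(A),\qquad j=1,\ldots,n-1.$$
   Context: For $\alpha\subseteq\{1,\ldots,n\}$ let $A[\alpha]$ denote the principal minor of the $n\times n$ matrix $A$ with rows and columns indexed by $\alpha$, with $A[\emptyset]:=1$, and let $\#\alpha$ be the size of $\alpha$. An $M$-matrix (possibly singular) is a real square matrix all of whose principal minors are nonnegative and all of whose off-diagonal entries are nonpositive. An inverse $M$-matrix is an invertible matrix whose inverse is an $M$-matrix. The normalized coefficients of the characteristic polynomial are $$c_j(A):=\binom{n}{j}^{-1}\sum_{\#\alpha=j}A[\alpha],\qquad j=0,\ldots,n.$$ These depend only on the similarity class of $A$; equivalently, $\binom{n}{j}c_j(A)$ is the $j$th elementary symmetric function of the eigenvalues of $A$ (with multiplicity). *)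

theory Defs
  imports
    Complex_Main
    "Jordan_Normal_Form.Determinant"
    "Jordan_Normal_Form.DL_Submatrix"
begin

(* Rows and columns are indexed by {..<n} instead of {1..n}.  The determinant of the
   empty matrix is 1, so the minor at the empty set is 1. *)
definition principal_minor :: "'a :: comm_ring_1 mat \<Rightarrow> nat set \<Rightarrow> 'a" where
  "principal_minor A \<alpha> = det (submatrix A \<alpha> \<alpha>)"

definition M_matrix :: "real mat \<Rightarrow> bool" where
  "M_matrix B \<longleftrightarrow>
     square_mat B \<and>
     (\<forall>\<alpha>. \<alpha> \<subseteq> {..<dim_row B} \<longrightarrow> principal_minor B \<alpha> \<ge> 0) \<and>
     (\<forall>i<dim_row B. \<forall>j<dim_row B. i \<noteq> j \<longrightarrow> B $$ (i, j) \<le> 0)"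

definition inverse_M_matrix :: "real mat \<Rightarrow> bool" where
  "inverse_M_matrix B \<longleftrightarrow>
     square_mat B \<and> (\<exists>C. inverts_mat B C \<and> inverts_mat C B \<and> M_matrix C)"

definition normalized_coeff :: "complex mat \<Rightarrow> nat \<Rightarrow> complex" where
  "normalized_coeff A j =
     (\<Sum>\<alpha> | \<alpha> \<subseteq> {..<dim_row A} \<and> card \<alpha> = j. principal_minor A \<alpha>)
       / of_nat (dim_row A choose j)"

lemma principal_minor_empty: "principal_minor A {} = 1"
  by (simp add: principal_minor_def submatrix_def)

end

(* Write mu S for the principal minor on S. Expanding a determinant along the cycles through an
   index i gives mu (S + i) = a_ii mu S - (sum over nonempty D in S of w_i D * mu (S - D)), where
   for an M-matrix the total weight w_i D of the cycles through i with remaining vertices D is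
   nonnegative, because each such cycle contributes a product of absolute values.  This recursion
   survives contraction mu (g + _), the combinatorial counterpart of a Schur complement.

   By induction on the size n of the ground set, the recursion shows that the averages of
   mu S * mu (V - S) over all S of size j increase for 2 j <= n + 1.  Grouping the pairs (a, b) of
   index sets by their intersection and symmetric difference, the case n = 2 j of this, applied to
   contractions, compares the sum over card a = j - 1, card b = j + 1 with the sum over
   card a = card b = j in which each pair carries the weight k / (k + 1), where k = card (a - b).
   The kernel 1 / (k + 1) is positive semidefinite, being the integral of t^k, with constant row
   sums on the sets of size j; subtracting the mean therefore bounds the weighted sum by exactly
   the constant that occurs in Newton's inequality.

   For inverse M-matrices the coefficients are reversed and multiplied by a determinant. *)
theory Submission
  imports Defs "Jordan_Normal_Form.Char_Poly"
begin

section \<open>Set functions with a cycle expansion\<close>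

text \<open>A pair D inside S is the same datum as the disjoint pair (D, S - D). This exchange makes
  subset convolution, (f * g) X = sum of f D * g (X - D) over D inside X, associative.\<close>

lemma sum_Pow_Pow:
  fixes h :: "'a set \<Rightarrow> 'a set \<Rightarrow> 'b::comm_monoid_add"
  assumes "finite U"
  shows "(\<Sum>S\<in>Pow U. \<Sum>D\<in>Pow S. h D (S - D)) = (\<Sum>D\<in>Pow U. \<Sum>T\<in>Pow (U - D). h D T)"
proof -
  have fin: "finite (Pow U)" "\<And>S. S \<in> Pow U \<Longrightarrow> finite (Pow S)" "\<And>S. finite (Pow (U - S))"
    using assms by (auto intro: finite_subset[OF _ assms])
  have "(\<Sum>S\<in>Pow U. \<Sum>D\<in>Pow S. h D (S - D)) = (\<Sum>(S, D)\<in>Sigma (Pow U) Pow. h D (S - D))"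
    by (rule sum.Sigma) (use fin in auto)
  also have "\<dots> = (\<Sum>(D, T)\<in>Sigma (Pow U) (\<lambda>D. Pow (U - D)). h D T)"
    by (rule sum.reindex_bij_witness[of _ "\<lambda>(D, T). (D \<union> T, D)" "\<lambda>(S, D). (D, S - D)"]) auto
  also have "\<dots> = (\<Sum>D\<in>Pow U. \<Sum>T\<in>Pow (U - D). h D T)"
    by (rule sum.Sigma[symmetric]) (use fin in auto)
  finally show ?thesis .
qed

lemma sum_Pow_insert:
  fixes h :: "'a set \<Rightarrow> 'b::comm_monoid_add"
  assumes "finite S" "g \<notin> S"
  shows "(\<Sum>D\<in>Pow (insert g S). h D) = (\<Sum>D\<in>Pow S. h D) + (\<Sum>D\<in>Pow S. h (insert g D))"
proof -
  have inj: "inj_on (insert g) (Pow S)"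
    by (intro inj_on_inverseI[of _ "\<lambda>T. T - {g}"]) (use assms(2) in auto)
  have "(\<Sum>D\<in>insert g ` Pow S. h D) = (\<Sum>D\<in>Pow S. h (insert g D))"
    by (simp only: sum.reindex[OF inj] o_def)
  moreover have "Pow S \<inter> insert g ` Pow S = {}" using assms(2) by auto
  ultimately show ?thesis using assms(1) by (simp add: Pow_insert sum.union_disjoint)
qed

text \<open>The value of \<open>w\<close> at the empty set is \<open>- a\<^bsub>ii\<^esub>\<close> for principal minors, hence the
  unconstrained sign there.\<close>

definition cycle_expansion :: "'a set \<Rightarrow> ('a set \<Rightarrow> real) \<Rightarrow> bool" where
  "cycle_expansion V \<mu> \<longleftrightarrow>
     (\<forall>S\<subseteq>V. 0 \<le> \<mu> S) \<and>
     (\<forall>i\<in>V. \<exists>w. (\<forall>D. D \<noteq> {} \<longrightarrow> 0 \<le> w D) \<and>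
        (\<forall>S\<subseteq>V - {i}. \<mu> (insert i S) = - (\<Sum>D\<in>Pow S. w D * \<mu> (S - D))))"

lemma cycle_expansion_nonneg: "cycle_expansion V \<mu> \<Longrightarrow> S \<subseteq> V \<Longrightarrow> 0 \<le> \<mu> S"
  by (simp add: cycle_expansion_def)

lemma cycle_expansionE:
  assumes "cycle_expansion V \<mu>" "i \<in> V"
  obtains w where "\<And>D. D \<noteq> {} \<Longrightarrow> 0 \<le> w D"
    "\<And>S. S \<subseteq> V - {i} \<Longrightarrow> \<mu> (insert i S) = - (\<Sum>D\<in>Pow S. w D * \<mu> (S - D))"
proof -
  have "\<exists>w. (\<forall>D. D \<noteq> {} \<longrightarrow> 0 \<le> w D) \<and>
      (\<forall>S\<subseteq>V - {i}. \<mu> (insert i S) = - (\<Sum>D\<in>Pow S. w D * \<mu> (S - D)))"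
    using assms by (simp add: cycle_expansion_def)
  then obtain w where "(\<forall>D. D \<noteq> {} \<longrightarrow> 0 \<le> w D) \<and>
      (\<forall>S\<subseteq>V - {i}. \<mu> (insert i S) = - (\<Sum>D\<in>Pow S. w D * \<mu> (S - D)))" ..
  then show ?thesis by (intro that[of w]) simp_all
qed

lemma cycle_expansionI:
  assumes "\<And>S. S \<subseteq> V \<Longrightarrow> 0 \<le> \<mu> S"
    and "\<And>i. i \<in> V \<Longrightarrow> \<exists>w. (\<forall>D. D \<noteq> {} \<longrightarrow> 0 \<le> w D) \<and>
        (\<forall>S\<subseteq>V - {i}. \<mu> (insert i S) = - (\<Sum>D\<in>Pow S. w D * \<mu> (S - D)))"
  shows "cycle_expansion V \<mu>"
  using assms by (simp add: cycle_expansion_def)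

lemma cycle_expansion_subset:
  assumes "cycle_expansion V \<mu>" "U \<subseteq> V"
  shows "cycle_expansion U \<mu>"
proof (rule cycle_expansionI)
  show "0 \<le> \<mu> S" if "S \<subseteq> U" for S
    using cycle_expansion_nonneg[OF assms(1), of S] that assms(2) by simp
  fix i assume "i \<in> U"
  then have "i \<in> V" using assms(2) by blast
  then obtain w where w: "\<And>D. D \<noteq> {} \<Longrightarrow> 0 \<le> w D"
      "\<And>S. S \<subseteq> V - {i} \<Longrightarrow> \<mu> (insert i S) = - (\<Sum>D\<in>Pow S. w D * \<mu> (S - D))"
    using cycle_expansionE[OF assms(1)] by metis
  have "S \<subseteq> V - {i}" if "S \<subseteq> U - {i}" for S using that assms(2) by blast
  then show "\<exists>w. (\<forall>D. D \<noteq> {} \<longrightarrow> 0 \<le> w D) \<and>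
        (\<forall>S\<subseteq>U - {i}. \<mu> (insert i S) = - (\<Sum>D\<in>Pow S. w D * \<mu> (S - D)))"
    using w by (intro exI[of _ w]) simp
qed

section \<open>Inversion under subset convolution and stability under contraction\<close>

text \<open>The inverse of delta - w under subset convolution, with w read as 0 at the empty set:
  unfolded, it sums the products of w over all ordered partitions of E into nonempty blocks. The
  value 1 is the empty product at the empty set; on infinite sets it is a default that keeps the
  function nonnegative.\<close>

function convolution_inverse :: "('a set \<Rightarrow> real) \<Rightarrow> 'a set \<Rightarrow> real" where
  "convolution_inverse w E = (if finite E \<and> E \<noteq> {}
     then (\<Sum>D\<in>Pow E - {{}}. w D * convolution_inverse w (E - D)) else 1)"
  by auto
termination
  by (relation "measure (\<lambda>(w, E). card E)") (auto intro!: psubset_card_mono)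

declare convolution_inverse.simps [simp del]

lemma convolution_inverse_nonneg:
  assumes "\<And>D. D \<noteq> {} \<Longrightarrow> 0 \<le> w D"
  shows "0 \<le> convolution_inverse w E"
  using assms
proof (induction w E rule: convolution_inverse.induct)
  case (1 w E)
  show ?case
    by (subst convolution_inverse.simps) (auto intro!: sum_nonneg mult_nonneg_nonneg 1)
qed

text \<open>In terms of subset convolution the hypothesis reads (delta - w) * f = h, and convolving
  with the inverse gives f. The proof substitutes the induction hypothesis into w * f, where only
  proper subsets occur because w vanishes at the empty set.\<close>

lemma convolution_inversion:
  assumes "finite X" "w {} = 0"
    and rec: "\<And>Y. Y \<subseteq> X \<Longrightarrow> f Y = h Y + (\<Sum>D\<in>Pow Y. w D * f (Y - D))"
  shows "f X = (\<Sum>D\<in>Pow X. convolution_inverse w D * h (X - D))"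
  using assms(1) rec
proof (induction X rule: finite_psubset_induct)
  case (psubset X)
  let ?u = "convolution_inverse w"
  have "(\<Sum>D\<in>Pow X. w D * f (X - D)) = (\<Sum>D\<in>Pow X. \<Sum>T\<in>Pow (X - D). w D * (?u T * h (X - D - T)))"
  proof (rule sum.cong[OF refl])
    fix D assume D: "D \<in> Pow X"
    show "w D * f (X - D) = (\<Sum>T\<in>Pow (X - D). w D * (?u T * h (X - D - T)))"
    proof (cases "D = {}")
      case False
      then have "X - D \<subset> X" using D by blast
      then have "f (X - D) = (\<Sum>T\<in>Pow (X - D). ?u T * h (X - D - T))"
        by (intro psubset.IH psubset.prems) blast+
      then show ?thesis by (simp only: sum_distrib_left)
    qed (simp add: assms(2))
  qed
  also have "\<dots> = (\<Sum>D\<in>Pow X. \<Sum>T\<in>Pow (X - D). w D * (?u T * h (X - (D \<union> T))))"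
    by (simp add: Diff_eq Int_assoc)
  also have "\<dots> = (\<Sum>S\<in>Pow X. \<Sum>D\<in>Pow S. w D * (?u (S - D) * h (X - (D \<union> (S - D)))))"
    by (rule sum_Pow_Pow[OF psubset.hyps, symmetric])
  also have "\<dots> = (\<Sum>S\<in>Pow X. (\<Sum>D\<in>Pow S. w D * ?u (S - D)) * h (X - S))"
    unfolding sum_distrib_right
    by (intro sum.cong refl) (auto simp: Un_absorb1 mult.assoc Un_Diff_cancel)
  finally have 1: "(\<Sum>D\<in>Pow X. w D * f (X - D)) = \<dots>" .
  \<comment> \<open>The defining recursion in convolution form: w * u = u - delta.\<close>
  have u: "(\<Sum>D\<in>Pow S. w D * ?u (S - D)) = (if S = {} then 0 else ?u S)" if "S \<in> Pow X" for S
  proof (cases "S = {}")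
    case False
    have fS: "finite S" using that psubset.hyps finite_subset by blast
    have "(\<Sum>D\<in>Pow S. w D * ?u (S - D)) = (\<Sum>D\<in>Pow S - {{}}. w D * ?u (S - D))"
      using fS assms(2) by (subst sum.remove[of _ "{}"]) auto
    then show ?thesis using False fS by (subst (2) convolution_inverse.simps) simp
  qed (simp add: assms(2))
  have u0: "?u {} = 1" by (simp add: convolution_inverse.simps)
  have "(\<Sum>D\<in>Pow X. w D * f (X - D)) = (\<Sum>S\<in>Pow X - {{}}. ?u S * h (X - S))"
  proof -
    have "(\<Sum>D\<in>Pow X. w D * f (X - D)) = (\<Sum>S\<in>Pow X. if S = {} then 0 else ?u S * h (X - S))"
      unfolding 1 by (intro sum.cong refl) (simp add: u)
    also have "\<dots> = (\<Sum>S\<in>Pow X - {{}}. if S = {} then 0 else ?u S * h (X - S))"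
      using psubset.hyps by (intro sum.mono_neutral_right) auto
    finally show ?thesis by simp
  qed
  then have "f X = ?u {} * h (X - {}) + (\<Sum>S\<in>Pow X - {{}}. ?u S * h (X - S))"
    using psubset.prems[OF order_refl] u0 by (simp only: mult_1 Diff_empty)
  also have "\<dots> = (\<Sum>S\<in>Pow X. ?u S * h (X - S))"
    using psubset.hyps by (intro sum.remove[symmetric]) auto
  finally show ?case .
qed

text \<open>Cycles through i that also meet g leave behind values of \<open>\<mu>\<close> on sets
  without g. The recursion at g, solved for these values by convolution inversion, turns them into
  nonnegative combinations of values of the contraction, so the new weights on nonempty sets stay
  nonnegative.\<close>

lemma cycle_expansion_contract:
  assumes "finite V" "cycle_expansion V \<mu>" "g \<in> V"
  shows "cycle_expansion (V - {g}) (\<lambda>S. \<mu> (insert g S))"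
proof -
  let ?V = "V - {g}"
  have nn: "\<And>S. S \<subseteq> V \<Longrightarrow> 0 \<le> \<mu> S" using cycle_expansion_nonneg[OF assms(2)] .
  obtain w where w: "\<And>D. D \<noteq> {} \<Longrightarrow> 0 \<le> w D"
    and wg: "\<And>S. S \<subseteq> ?V \<Longrightarrow> \<mu> (insert g S) = - (\<Sum>D\<in>Pow S. w D * \<mu> (S - D))"
    using cycle_expansionE[OF assms(2,3)] by metis
  \<comment> \<open>For principal minors \<open>a\<close> is the diagonal entry at g. Splitting it
    off leaves weights \<open>w0\<close> that are nonnegative everywhere.\<close>
  define a where "a = - w {}"
  define w0 where "w0 D = (if D = {} then 0 else w D)" for D
  have w0: "0 \<le> w0 D" for D using w by (simp add: w0_def)
  have rec: "\<mu> (insert g S) = a * \<mu> S - (\<Sum>D\<in>Pow S. w0 D * \<mu> (S - D))" if "S \<subseteq> ?V" for S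
  proof -
    have "finite (Pow S)" using that assms(1) by (meson finite_Diff finite_Pow_iff finite_subset)
    then have s: "(\<Sum>D\<in>Pow S. k D) = k {} + (\<Sum>D\<in>Pow S - {{}}. k D)" for k :: "'a set \<Rightarrow> real"
      by (intro sum.remove) auto
    have "(\<Sum>D\<in>Pow S - {{}}. w0 D * \<mu> (S - D)) = (\<Sum>D\<in>Pow S - {{}}. w D * \<mu> (S - D))"
      by (intro sum.cong) (auto simp: w0_def)
    then show ?thesis unfolding wg[OF that] s by (simp add: a_def w0_def)
  qed
  \<comment> \<open>The existence premise excludes a contraction that is identically zero, and
    thereby forces a > 0: for a <= 0 the recursion makes every \<open>\<mu> (insert g Y)\<close>
    nonpositive, hence 0.\<close>
  obtain u where u: "\<And>D. 0 \<le> u D"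
    and inv: "\<And>X. X \<subseteq> ?V \<Longrightarrow> (\<exists>Y\<subseteq>?V. \<mu> (insert g Y) \<noteq> 0) \<Longrightarrow>
                \<mu> X = (\<Sum>D\<in>Pow X. u D * \<mu> (insert g (X - D)))"
  proof (cases "a > 0")
    case True
    define u where "u D = convolution_inverse (\<lambda>D. w0 D / a) D / a" for D
    show ?thesis
    proof
      show "0 \<le> u D" for D unfolding u_def using True w0
        by (intro divide_nonneg_pos convolution_inverse_nonneg) auto
      fix X assume X: "X \<subseteq> ?V"
      have "\<mu> X = (\<Sum>D\<in>Pow X. convolution_inverse (\<lambda>D. w0 D / a) D * (\<mu> (insert g (X - D)) / a))"
      proof (rule convolution_inversion)
        show "finite X" using X assms(1) finite_subset by blast
        fix Y assume "Y \<subseteq> X"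
        then have "\<mu> (insert g Y) = a * \<mu> Y - (\<Sum>D\<in>Pow Y. w0 D * \<mu> (Y - D))"
          using X by (intro rec) auto
        then show "\<mu> Y = \<mu> (insert g Y) / a + (\<Sum>D\<in>Pow Y. w0 D / a * \<mu> (Y - D))"
          using True by (simp add: field_simps flip: sum_divide_distrib)
      qed (simp add: w0_def)
      then show "\<mu> X = (\<Sum>D\<in>Pow X. u D * \<mu> (insert g (X - D)))" by (simp add: u_def)
    qed
  next
    case False
    have "\<mu> (insert g Y) = 0" if "Y \<subseteq> ?V" for Y
    proof -
      have "a * \<mu> Y \<le> 0" using False nn[of Y] that by (intro mult_nonpos_nonneg) auto
      moreover have "0 \<le> (\<Sum>D\<in>Pow Y. w0 D * \<mu> (Y - D))"
        using that by (intro sum_nonneg mult_nonneg_nonneg w0 nn) auto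
      ultimately have "\<mu> (insert g Y) \<le> 0" using rec[OF that] by linarith
      moreover have "0 \<le> \<mu> (insert g Y)" using that assms(3) by (intro nn) auto
      ultimately show ?thesis by simp
    qed
    then show ?thesis using that[of "\<lambda>_. 0"] by force
  qed
  show ?thesis
  proof (rule cycle_expansionI)
    show "0 \<le> \<mu> (insert g S)" if "S \<subseteq> ?V" for S using that assms(3) by (intro nn) auto
    fix i assume i: "i \<in> ?V"
    show "\<exists>w. (\<forall>D. D \<noteq> {} \<longrightarrow> 0 \<le> w D) \<and> (\<forall>S\<subseteq>?V - {i}.
        \<mu> (insert g (insert i S)) = - (\<Sum>D\<in>Pow S. w D * \<mu> (insert g (S - D))))"
    \<comment> \<open>If the contraction vanishes identically, zero weights do; otherwise the
      inversion at g is available.\<close>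
    proof (cases "\<exists>Y\<subseteq>?V. \<mu> (insert g Y) \<noteq> 0")
      case False
      have "\<mu> (insert g (insert i S)) = 0" if "S \<subseteq> ?V - {i}" for S
        using False that i by (metis Diff_iff Diff_subset insert_subset order_trans)
      then show ?thesis by (intro exI[of _ "\<lambda>_. 0"]) simp
    next
      case True
      obtain v where v: "\<And>D. D \<noteq> {} \<Longrightarrow> 0 \<le> v D"
        and vi: "\<And>S. S \<subseteq> V - {i} \<Longrightarrow> \<mu> (insert i S) = - (\<Sum>D\<in>Pow S. v D * \<mu> (S - D))"
        using cycle_expansionE[OF assms(2)] i by (metis DiffD1)
      \<comment> \<open>A cycle through i with remaining vertices E avoids g and contributes v E, or
        it passes through g and a set D, and the inversion at g then adds the vertices E -
        D.\<close>
      let ?w = "\<lambda>E. v E + (\<Sum>D\<in>Pow E. v (insert g D) * u (E - D))"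
      have "\<mu> (insert g (insert i S)) = - (\<Sum>E\<in>Pow S. ?w E * \<mu> (insert g (S - E)))"
        if S: "S \<subseteq> ?V - {i}" for S
      proof -
        have g: "g \<notin> S" using S by auto
        have fS: "finite S" using S assms(1) by (meson finite_Diff finite_subset)
        have "\<mu> (insert g (insert i S)) = \<mu> (insert i (insert g S))" by (simp add: insert_commute)
        also have "\<dots> = - (\<Sum>D\<in>Pow (insert g S). v D * \<mu> (insert g S - D))"
          using S assms(3) i by (intro vi) auto
        also have "(\<Sum>D\<in>Pow (insert g S). v D * \<mu> (insert g S - D)) =
            (\<Sum>D\<in>Pow S. v D * \<mu> (insert g S - D)) +
            (\<Sum>D\<in>Pow S. v (insert g D) * \<mu> (insert g S - insert g D))"
          by (rule sum_Pow_insert[OF fS g])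
        also have "(\<Sum>D\<in>Pow S. v D * \<mu> (insert g S - D)) = (\<Sum>D\<in>Pow S. v D * \<mu> (insert g (S - D)))"
        proof (intro sum.cong refl)
          fix D assume "D \<in> Pow S"
          then have "insert g S - D = insert g (S - D)" using g by blast
          then show "v D * \<mu> (insert g S - D) = v D * \<mu> (insert g (S - D))" by simp
        qed
        also have "(\<Sum>D\<in>Pow S. v (insert g D) * \<mu> (insert g S - insert g D)) =
            (\<Sum>D\<in>Pow S. \<Sum>T\<in>Pow (S - D). v (insert g D) * (u T * \<mu> (insert g (S - (D \<union> T)))))"
        proof (intro sum.cong refl)
          fix D assume "D \<in> Pow S"
          have "insert g S - insert g D = S - D" using g by blast
          moreover have "\<mu> (S - D) = (\<Sum>T\<in>Pow (S - D). u T * \<mu> (insert g (S - D - T)))"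
            using S by (intro inv True) auto
          ultimately show "v (insert g D) * \<mu> (insert g S - insert g D) =
              (\<Sum>T\<in>Pow (S - D). v (insert g D) * (u T * \<mu> (insert g (S - (D \<union> T)))))"
            by (simp add: sum_distrib_left Diff_eq Int_assoc)
        qed
        also have "\<dots> = (\<Sum>E\<in>Pow S. \<Sum>D\<in>Pow E. v (insert g D) * (u (E - D) * \<mu> (insert g (S - (D \<union> (E - D))))))"
          by (rule sum_Pow_Pow[OF fS, symmetric])
        also have "\<dots> = (\<Sum>E\<in>Pow S. (\<Sum>D\<in>Pow E. v (insert g D) * u (E - D)) * \<mu> (insert g (S - E)))"
          unfolding sum_distrib_right
          by (intro sum.cong refl) (auto simp: Un_absorb1 mult.assoc)
        finally show ?thesis by (simp add: sum.distrib algebra_simps)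
      qed
      moreover have "0 \<le> ?w E" if "E \<noteq> {}" for E
        using that v u by (intro add_nonneg_nonneg sum_nonneg mult_nonneg_nonneg) auto
      ultimately show ?thesis by (intro exI[of _ ?w]) simp
    qed
  qed
qed

lemma cycle_expansion_contract_set:
  assumes "finite V" "cycle_expansion V \<mu>" "G \<subseteq> V"
  shows "cycle_expansion (V - G) (\<lambda>S. \<mu> (G \<union> S))"
proof -
  have "finite G" using assms finite_subset by blast
  then show ?thesis using assms(3)
  proof (induction G rule: finite_induct)
    case empty
    then show ?case using assms(2) by simp
  next
    case (insert g G)
    then have "cycle_expansion (V - G - {g}) (\<lambda>S. \<mu> (G \<union> insert g S))"
      using assms(1) by (intro cycle_expansion_contract) auto
    moreover have "V - G - {g} = V - insert g G" by blast
    ultimately show ?case by simp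
  qed
qed

section \<open>Sums over complementary pairs\<close>

definition complementary_sum :: "('a set \<Rightarrow> real) \<Rightarrow> 'a set \<Rightarrow> nat \<Rightarrow> real" where
  "complementary_sum \<mu> V j = (\<Sum>S | S \<subseteq> V \<and> card S = j. \<mu> S * \<mu> (V - S))"

lemma complementary_sum_sym:
  assumes "finite V" "j \<le> card V"
  shows "complementary_sum \<mu> V (card V - j) = complementary_sum \<mu> V j"
proof -
  have c: "card (V - S) = card V - card S" "card S \<le> card V" if "S \<subseteq> V" for S
    using assms(1) card_Diff_subset[OF finite_subset[OF that assms(1)] that] card_mono[OF assms(1) that] by auto
  show ?thesis
    unfolding complementary_sum_def
    by (rule sum.reindex_bij_witness[of _ "\<lambda>S. V - S" "\<lambda>S. V - S"])
       (use assms(2) in \<open>auto simp: double_diff c mult.commute\<close>)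
qed

lemma complementary_sum_nonneg:
  assumes "cycle_expansion V \<mu>"
  shows "0 \<le> complementary_sum \<mu> V j"
  unfolding complementary_sum_def by (intro sum_nonneg mult_nonneg_nonneg cycle_expansion_nonneg[OF assms]) auto

text \<open>The one-step inequality is a hypothesis because \<open>complementary_sum_step\<close>
  supplies it from its own induction hypothesis. Up to the middle, j <= card V - j + 1 turns the
  comparison of averages into one of sums; an index a beyond the middle is reflected to card V - a,
  which is still at least b.\<close>

lemma complementary_sum_mono_if_step:
  assumes "finite V" and ce: "cycle_expansion V \<mu>"
    and step: "\<And>j. 1 \<le> j \<Longrightarrow> 2 * j \<le> card V + 1 \<Longrightarrow>
       real (card V - j + 1) * complementary_sum \<mu> V (j - 1) \<le> real j * complementary_sum \<mu> V j"
    and "b \<le> a" "a + b \<le> card V"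
  shows "complementary_sum \<mu> V b \<le> complementary_sum \<mu> V a"
proof -
  let ?g = "complementary_sum \<mu> V"
  have step': "?g j \<le> ?g (Suc j)" if "2 * Suc j \<le> card V + 1" for j
  proof -
    have "real (Suc j) * ?g j \<le> real (card V - Suc j + 1) * ?g j"
      using that complementary_sum_nonneg[OF ce] by (intro mult_right_mono) auto
    also have "\<dots> \<le> real (Suc j) * ?g (Suc j)" using step[of "Suc j"] that by simp
    finally show ?thesis by (simp del: of_nat_Suc)
  qed
  have mono: "?g b \<le> ?g c" if "b \<le> c" "2 * c \<le> card V + 1" for b c
    using that
  proof (induction c rule: dec_induct)
    case (step k)
    then show ?case using step'[of k] by simp
  qed simp
  show ?thesis
  proof (cases "2 * a \<le> card V + 1")
    case True
    then show ?thesis using mono assms by simp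
  next
    case False
    then have "?g b \<le> ?g (card V - a)" using assms by (intro mono) auto
    then show ?thesis using complementary_sum_sym[of V a \<mu>] assms by simp
  qed
qed

lemma complementary_sum_Pow:
  assumes "finite V"
  shows "complementary_sum \<mu> V j = (\<Sum>S\<in>Pow V. if card S = j then \<mu> S * \<mu> (V - S) else 0)"
  unfolding complementary_sum_def
  by (subst sum.inter_filter[symmetric]) (use assms in \<open>auto intro: sum.cong\<close>)

lemma sum_Pow_swap:
  fixes h :: "'a set \<Rightarrow> 'a set \<Rightarrow> 'b::comm_monoid_add"
  assumes "finite U"
  shows "(\<Sum>S\<in>Pow U. \<Sum>D\<in>Pow (U - S). h S D) = (\<Sum>D\<in>Pow U. \<Sum>S\<in>Pow (U - D). h S D)"
proof -
  have "(\<Sum>S\<in>Pow U. \<Sum>D\<in>Pow (U - S). h S D) = (\<Sum>(S, D)\<in>Sigma (Pow U) (\<lambda>S. Pow (U - S)). h S D)"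
    by (rule sum.Sigma) (use assms in auto)
  also have "\<dots> = (\<Sum>(D, S)\<in>Sigma (Pow U) (\<lambda>D. Pow (U - D)). h S D)"
    by (rule sum.reindex_bij_witness[of _ prod.swap prod.swap]) auto
  also have "\<dots> = (\<Sum>D\<in>Pow U. \<Sum>S\<in>Pow (U - D). h S D)"
    by (rule sum.Sigma[symmetric]) (use assms in auto)
  finally show ?thesis .
qed

text \<open>Marking an element i of S on the right and of V - S on the left makes both sides sums
  over i and subsets of V - {i} of size j - 1; they differ only in the factor that i joins.
  Expanding this factor along the cycles through i cancels the terms for empty D and leaves, for
  each nonempty D, a comparison of complementary sums on the smaller set V - {i} - D.\<close>

lemma complementary_sum_step:
  assumes "finite V" "cycle_expansion V \<mu>" "1 \<le> j" "2 * j \<le> card V + 1"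
  shows "real (card V - j + 1) * complementary_sum \<mu> V (j - 1) \<le> real j * complementary_sum \<mu> V j"
  using assms
proof (induction "card V" arbitrary: V j rule: less_induct)
  case less
  note fV = less.prems(1) and ce = less.prems(2)
  have cardS: "finite S" "card (V - S) = card V - card S" if "S \<subseteq> V" for S
    using finite_subset[OF that fV] card_Diff_subset[OF _ that] by auto
  let ?L = "\<lambda>i. {S. S \<subseteq> V - {i} \<and> card S = j - 1}"
  have "real j * complementary_sum \<mu> V j = (\<Sum>S | S \<subseteq> V \<and> card S = j. \<Sum>i\<in>S. \<mu> S * \<mu> (V - S))"
    unfolding complementary_sum_def sum_distrib_left by (intro sum.cong) auto
  also have "\<dots> = (\<Sum>(S, i)\<in>Sigma {S. S \<subseteq> V \<and> card S = j} (\<lambda>S. S). \<mu> S * \<mu> (V - S))"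
    by (rule sum.Sigma) (use fV cardS in auto)
  also have "\<dots> = (\<Sum>(i, S)\<in>Sigma V ?L. \<mu> (insert i S) * \<mu> (V - insert i S))"
  proof (rule sum.reindex_bij_witness[of _ "\<lambda>(i, S). (insert i S, i)" "\<lambda>(S, i). (i, S - {i})"])
    fix z assume "z \<in> Sigma {S. S \<subseteq> V \<and> card S = j} (\<lambda>S. S)"
    then obtain S i where z: "z = (S, i)" "S \<subseteq> V" "card S = j" "i \<in> S" by auto
    then show "(case z of (S, i) \<Rightarrow> (i, S - {i})) \<in> Sigma V ?L"
      using cardS(1)[OF z(2)] by auto
    show "(case case z of (S, i) \<Rightarrow> (i, S - {i}) of (i, S) \<Rightarrow> (insert i S, i)) = z"
      "(case case z of (S, i) \<Rightarrow> (i, S - {i}) of (i, S) \<Rightarrow> \<mu> (insert i S) * \<mu> (V - insert i S)) =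
        (case z of (S, i) \<Rightarrow> \<mu> S * \<mu> (V - S))"
      using z(4) by (simp_all add: z(1) insert_absorb)
  next
    fix z assume "z \<in> Sigma V ?L"
    then obtain S i where z: "z = (i, S)" "i \<in> V" "S \<subseteq> V" "i \<notin> S" "card S = j - 1" by auto
    then show "(case z of (i, S) \<Rightarrow> (insert i S, i)) \<in> Sigma {S. S \<subseteq> V \<and> card S = j} (\<lambda>S. S)"
      using cardS(1)[OF z(3)] less.prems(3) by auto
    show "(case case z of (i, S) \<Rightarrow> (insert i S, i) of (S, i) \<Rightarrow> (i, S - {i})) = z"
      using z(4) by (simp add: z(1))
  qed
  also have "\<dots> = (\<Sum>i\<in>V. \<Sum>S\<in>?L i. \<mu> (insert i S) * \<mu> (V - insert i S))"
    by (rule sum.Sigma[symmetric]) (use fV in auto)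
  also have "\<dots> = (\<Sum>i\<in>V. \<Sum>S\<in>?L i. \<mu> (insert i S) * \<mu> (V - {i} - S))"
  proof (intro sum.cong refl)
    fix i S
    show "\<mu> (insert i S) * \<mu> (V - insert i S) = \<mu> (insert i S) * \<mu> (V - {i} - S)"
      by (simp only: Diff_insert2[of V i S])
  qed
  finally have gj: "real j * complementary_sum \<mu> V j = \<dots>" .
  have "real (card V - j + 1) * complementary_sum \<mu> V (j - 1) =
      (\<Sum>S | S \<subseteq> V \<and> card S = j - 1. \<Sum>i\<in>V - S. \<mu> S * \<mu> (V - S))"
    unfolding complementary_sum_def sum_distrib_left
  proof (intro sum.cong refl)
    fix S assume "S \<in> {S. S \<subseteq> V \<and> card S = j - 1}"
    then have "card (V - S) = card V - j + 1" using cardS(2)[of S] less.prems(3,4) by auto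
    then show "real (card V - j + 1) * (\<mu> S * \<mu> (V - S)) = (\<Sum>i\<in>V - S. \<mu> S * \<mu> (V - S))"
      by simp
  qed
  also have "\<dots> = (\<Sum>(S, i)\<in>Sigma {S. S \<subseteq> V \<and> card S = j - 1} (\<lambda>S. V - S). \<mu> S * \<mu> (V - S))"
    by (rule sum.Sigma) (use fV in auto)
  also have "\<dots> = (\<Sum>(i, S)\<in>Sigma V ?L. \<mu> S * \<mu> (insert i (V - {i} - S)))"
  proof (rule sum.reindex_bij_witness[of _ "\<lambda>(i, S). (S, i)" "\<lambda>(S, i). (i, S)"])
    fix z assume "z \<in> Sigma {S. S \<subseteq> V \<and> card S = j - 1} (\<lambda>S. V - S)"
    then obtain S i where z: "z = (S, i)" "S \<subseteq> V" "i \<in> V" "i \<notin> S" by auto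
    then have "insert i (V - {i} - S) = V - S" by auto
    then show "(case case z of (S, i) \<Rightarrow> (i, S) of (i, S) \<Rightarrow> \<mu> S * \<mu> (insert i (V - {i} - S))) =
        (case z of (S, i) \<Rightarrow> \<mu> S * \<mu> (V - S))" by (simp add: z)
  qed auto
  also have "\<dots> = (\<Sum>i\<in>V. \<Sum>S\<in>?L i. \<mu> S * \<mu> (insert i (V - {i} - S)))"
    by (rule sum.Sigma[symmetric]) (use fV in auto)
  finally have gj': "real (card V - j + 1) * complementary_sum \<mu> V (j - 1) = \<dots>" .
  have "(\<Sum>S\<in>?L i. \<mu> S * \<mu> (insert i (V - {i} - S))) \<le>
      (\<Sum>S\<in>?L i. \<mu> (insert i S) * \<mu> (V - {i} - S))" if i: "i \<in> V" for i
  proof -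
    let ?U = "V - {i}"
    have fU: "finite ?U" and cU: "card ?U = card V - 1" "card V \<ge> 1"
      using fV i by (auto simp: Suc_le_eq card_gt_0_iff)
    have filt: "(\<Sum>S\<in>?L i. k S) = (\<Sum>S\<in>Pow ?U. if card S = j - 1 then k S else 0)" for k :: "_ \<Rightarrow> real"
      by (subst sum.inter_filter[symmetric]) (use fU in \<open>auto intro: sum.cong\<close>)
    obtain w where w: "\<And>D. D \<noteq> {} \<Longrightarrow> 0 \<le> w D"
      and wi: "\<And>S. S \<subseteq> ?U \<Longrightarrow> \<mu> (insert i S) = - (\<Sum>D\<in>Pow S. w D * \<mu> (S - D))"
      using cycle_expansionE[OF ce i] by metis
    \<comment> \<open>The condition is additive so that \<open>P D\<close> is 0 when D has more than
      j - 1 elements; otherwise \<open>P D\<close> is the complementary sum on \<open>?U - D\<close>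
      at j - 1 - card D.\<close>
    define P where "P D = (\<Sum>T\<in>Pow (?U - D). if card D + card T = j - 1 then \<mu> T * \<mu> (?U - D - T) else 0)" for D
    have "(\<Sum>S\<in>?L i. \<mu> (insert i S) * \<mu> (?U - S)) =
        (\<Sum>S\<in>Pow ?U. \<Sum>D\<in>Pow S. if card D + card (S - D) = j - 1
            then - w D * (\<mu> (S - D) * \<mu> (?U - D - (S - D))) else 0)"
      unfolding filt
    proof (intro sum.cong refl)
      fix S assume S: "S \<in> Pow ?U"
      have fS: "finite S" using S fU by (meson PowD finite_subset)
      have "(\<Sum>D\<in>Pow S. if card D + card (S - D) = j - 1
            then - w D * (\<mu> (S - D) * \<mu> (?U - D - (S - D))) else 0) =
          (\<Sum>D\<in>Pow S. if card S = j - 1 then - w D * \<mu> (S - D) * \<mu> (?U - S) else 0)"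
      proof (intro sum.cong refl)
        fix D assume D: "D \<in> Pow S"
        then have "card D + card (S - D) = card S"
          using fS by (simp add: card_Diff_subset finite_subset[of D S] card_mono)
        moreover have "?U - D - (S - D) = ?U - S" using D by auto
        ultimately show "(if card D + card (S - D) = j - 1
            then - w D * (\<mu> (S - D) * \<mu> (?U - D - (S - D))) else 0) =
            (if card S = j - 1 then - w D * \<mu> (S - D) * \<mu> (?U - S) else 0)" by simp
      qed
      then show "(if card S = j - 1 then \<mu> (insert i S) * \<mu> (?U - S) else 0) =
          (\<Sum>D\<in>Pow S. if card D + card (S - D) = j - 1
            then - w D * (\<mu> (S - D) * \<mu> (?U - D - (S - D))) else 0)"
        using S by (simp add: wi sum_distrib_right sum_negf)
    qed
    also have "\<dots> = (\<Sum>D\<in>Pow ?U. \<Sum>T\<in>Pow (?U - D). if card D + card T = j - 1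
            then - w D * (\<mu> T * \<mu> (?U - D - T)) else 0)"
      by (rule sum_Pow_Pow[OF fU])
    also have "\<dots> = - (\<Sum>D\<in>Pow ?U. w D * P D)"
      unfolding P_def sum_distrib_left sum_negf[symmetric] by (intro sum.cong refl) simp
    finally have upper: "(\<Sum>S\<in>?L i. \<mu> (insert i S) * \<mu> (?U - S)) = - (\<Sum>D\<in>Pow ?U. w D * P D)" .
    have "(\<Sum>S\<in>?L i. \<mu> S * \<mu> (insert i (?U - S))) =
        (\<Sum>S\<in>Pow ?U. \<Sum>D\<in>Pow (?U - S). if card S = j - 1 then - w D * (\<mu> S * \<mu> (?U - D - S)) else 0)"
      unfolding filt
    proof (intro sum.cong refl)
      fix S assume "S \<in> Pow ?U"
      have "?U - S - D = ?U - D - S" for D by auto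
      then show "(if card S = j - 1 then \<mu> S * \<mu> (insert i (?U - S)) else 0) =
          (\<Sum>D\<in>Pow (?U - S). if card S = j - 1 then - w D * (\<mu> S * \<mu> (?U - D - S)) else 0)"
        using wi[of "?U - S"] by (simp add: sum_distrib_left sum_negf ac_simps)
    qed
    also have "\<dots> = (\<Sum>D\<in>Pow ?U. \<Sum>S\<in>Pow (?U - D). if card S = j - 1 then - w D * (\<mu> S * \<mu> (?U - D - S)) else 0)"
      by (rule sum_Pow_swap[OF fU])
    also have "\<dots> = - (\<Sum>D\<in>Pow ?U. w D * complementary_sum \<mu> (?U - D) (j - 1))"
      unfolding complementary_sum_Pow[OF finite_Diff[OF fU]] sum_distrib_left sum_negf[symmetric]
      by (intro sum.cong refl) simp
    finally have lower: "(\<Sum>S\<in>?L i. \<mu> S * \<mu> (insert i (?U - S))) =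
        - (\<Sum>D\<in>Pow ?U. w D * complementary_sum \<mu> (?U - D) (j - 1))" .
    \<comment> \<open>Both expansions carry a minus sign, so \<open>P D\<close> has to be the
      smaller one. For empty D the two sides coincide, whatever the sign of
      \<open>w {}\<close>.\<close>
    have "w D * P D \<le> w D * complementary_sum \<mu> (?U - D) (j - 1)" if D: "D \<in> Pow ?U" for D
    proof (cases "D = {}")
      case True
      then show ?thesis unfolding P_def complementary_sum_Pow[OF finite_Diff[OF fU]] by simp
    next
      case False
      have fD: "finite D" using D fU by (meson PowD finite_subset)
      have D0: "card D > 0" using False fD by (simp add: card_gt_0_iff)
      have cUD: "card (?U - D) = card V - 1 - card D" "card D \<le> card V - 1"
        using D fD fU cU card_Diff_subset[of D ?U] card_mono[of ?U D] by auto
      have ceUD: "cycle_expansion (?U - D) \<mu>" by (rule cycle_expansion_subset[OF ce]) auto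
      have "P D \<le> complementary_sum \<mu> (?U - D) (j - 1)"
      proof (cases "card D \<le> j - 1")
        case True
        have "P D = complementary_sum \<mu> (?U - D) (j - 1 - card D)"
          unfolding P_def complementary_sum_Pow[OF finite_Diff[OF fU]] using True
          by (intro sum.cong refl if_cong) auto
        also have "\<dots> \<le> complementary_sum \<mu> (?U - D) (j - 1)"
        proof (rule complementary_sum_mono_if_step[OF _ ceUD])
          fix k assume k: "1 \<le> k" "2 * k \<le> card (?U - D) + 1"
          show "real (card (?U - D) - k + 1) * complementary_sum \<mu> (?U - D) (k - 1) \<le>
              real k * complementary_sum \<mu> (?U - D) k"
            using k cU D0 cUD fU by (intro less.hyps ceUD) auto
        next
          \<comment> \<open>The bound on j enters here: card V - 1 - card D elements are left, and 2
            * j - 2 - card D is at most this number exactly when 2 * j <= card V + 1.\<close>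
          show "j - 1 + (j - 1 - card D) \<le> card (?U - D)"
            using less.prems(3,4) cU cUD D0 True by auto
        qed (use fU in auto)
        finally show ?thesis .
      next
        case False
        then have "P D = 0" unfolding P_def by (intro sum.neutral) auto
        then show ?thesis using complementary_sum_nonneg[OF ceUD] by simp
      qed
      then show ?thesis using w[OF False] by (rule mult_left_mono)
    qed
    then have "(\<Sum>D\<in>Pow ?U. w D * P D) \<le> (\<Sum>D\<in>Pow ?U. w D * complementary_sum \<mu> (?U - D) (j - 1))"
      by (rule sum_mono)
    then show ?thesis unfolding upper lower by simp
  qed
  then show ?case unfolding gj gj' by (rule sum_mono)
qed

section \<open>Pairs of index sets on adjacent levels\<close>

text \<open>The new coordinates are the intersection G, the symmetric difference T and S = a - b;
  then b - a = T - S.\<close>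

lemma sum_pairs_by_overlap:
  fixes F :: "'a set \<Rightarrow> 'a set \<Rightarrow> 'b::comm_monoid_add"
  assumes "finite V"
  shows "(\<Sum>a\<in>Pow V. \<Sum>b\<in>Pow V. F a b) =
    (\<Sum>G\<in>Pow V. \<Sum>T\<in>Pow (V - G). \<Sum>S\<in>Pow T. F (G \<union> S) (G \<union> (T - S)))"
proof -
  have fin: "finite (Pow T)" if "T \<in> Pow (V - G)" for G T
    using that assms by (meson PowD finite_Diff finite_Pow_iff finite_subset)
  have "(\<Sum>a\<in>Pow V. \<Sum>b\<in>Pow V. F a b) = (\<Sum>(a, b)\<in>Pow V \<times> Pow V. F a b)"
    by (rule sum.cartesian_product)
  also have "\<dots> = (\<Sum>(G, T, S)\<in>Sigma (Pow V) (\<lambda>G. Sigma (Pow (V - G)) Pow). F (G \<union> S) (G \<union> (T - S)))"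
  proof (rule sum.reindex_bij_witness[of _ "\<lambda>(G, T, S). (G \<union> S, G \<union> (T - S))"
        "\<lambda>(a, b). (a \<inter> b, (a - b) \<union> (b - a), a - b)"])
    fix z assume "z \<in> Pow V \<times> Pow V"
    then obtain a b where z: "z = (a, b)" by auto
    have "a \<inter> b \<union> (a - b) = a" "a \<inter> b \<union> ((a - b) \<union> (b - a) - (a - b)) = b" by auto
    then show "(case case z of (a, b) \<Rightarrow> (a \<inter> b, (a - b) \<union> (b - a), a - b) of
        (G, T, S) \<Rightarrow> F (G \<union> S) (G \<union> (T - S))) = (case z of (a, b) \<Rightarrow> F a b)" by (simp add: z)
  qed auto
  also have "\<dots> = (\<Sum>G\<in>Pow V. \<Sum>(T, S)\<in>Sigma (Pow (V - G)) Pow. F (G \<union> S) (G \<union> (T - S)))"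
    using assms fin by (intro sum.Sigma[symmetric] ballI finite_SigmaI) auto
  also have "\<dots> = (\<Sum>G\<in>Pow V. \<Sum>T\<in>Pow (V - G). \<Sum>S\<in>Pow T. F (G \<union> S) (G \<union> (T - S)))"
    using assms fin by (intro sum.cong refl sum.Sigma[symmetric] ballI) auto
  finally show ?thesis .
qed

text \<open>For fixed intersection G and symmetric difference T, the relevant case is card T = 2 * k
  with k = j - card G, where both sides are multiples of complementary sums g on T of the
  contraction by G. The claim is then the middle case of \<open>complementary_sum_step\<close>, (k +
  1) * g (k - 1) <= k * g k, which is the origin of the weight k / (k + 1).\<close>

lemma sum_adjacent_levels_le:
  assumes fV: "finite V" and ce: "cycle_expansion V \<mu>"
  shows "(\<Sum>a\<in>Pow V. \<Sum>b\<in>Pow V. if card a + 1 = j \<and> card b = j + 1 then \<mu> a * \<mu> b else 0) \<le>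
    (\<Sum>a\<in>Pow V. \<Sum>b\<in>Pow V. if card a = j \<and> card b = j
        then card (a - b) / (card (a - b) + 1) * (\<mu> a * \<mu> b) else 0)"
  unfolding sum_pairs_by_overlap[OF fV]
proof (rule sum_mono, rule sum_mono)
  fix G T assume G: "G \<in> Pow V" and T: "T \<in> Pow (V - G)"
  define \<nu> where "\<nu> S = \<mu> (G \<union> S)" for S
  have ceT: "cycle_expansion T \<nu>"
    unfolding \<nu>_def using cycle_expansion_contract_set[OF fV ce, of G] G T
    by (intro cycle_expansion_subset[of "V - G" _ T]) auto
  have fin: "finite G" "finite T" using G T fV by (meson PowD finite_Diff finite_subset)+
  have card_simps: "card (G \<union> S) = card G + card S" "card (G \<union> (T - S)) = card G + (card T - card S)"
      "G \<union> S - (G \<union> (T - S)) = S" "card S \<le> card T"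
    if "S \<in> Pow T" for S
  proof -
    have "finite S" using that fin by (meson PowD finite_subset)
    moreover have "G \<inter> S = {}" "G \<inter> (T - S) = {}" using T that by auto
    ultimately show "card (G \<union> S) = card G + card S" "card (G \<union> (T - S)) = card G + (card T - card S)"
      "card S \<le> card T"
      using that fin by (simp_all add: card_Un_disjoint card_Diff_subset card_mono)
    show "G \<union> S - (G \<union> (T - S)) = S" using T that by auto
  qed
  have lhs: "(\<Sum>S\<in>Pow T. if card (G \<union> S) + 1 = j \<and> card (G \<union> (T - S)) = j + 1
          then \<mu> (G \<union> S) * \<mu> (G \<union> (T - S)) else 0) =
        (\<Sum>S\<in>Pow T. if card G + card S + 1 = j \<and> card G + (card T - card S) = j + 1
          then \<nu> S * \<nu> (T - S) else 0)"
    by (intro sum.cong refl) (simp only: card_simps \<nu>_def)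
  have rhs: "(\<Sum>S\<in>Pow T. if card (G \<union> S) = j \<and> card (G \<union> (T - S)) = j
          then card (G \<union> S - (G \<union> (T - S))) / (card (G \<union> S - (G \<union> (T - S))) + 1) *
            (\<mu> (G \<union> S) * \<mu> (G \<union> (T - S))) else 0) =
        (\<Sum>S\<in>Pow T. if card G + card S = j \<and> card G + (card T - card S) = j
          then card S / (card S + 1) * (\<nu> S * \<nu> (T - S)) else 0)"
    by (intro sum.cong refl) (simp only: card_simps \<nu>_def)
  have nn: "0 \<le> \<nu> S * \<nu> (T - S)" if "S \<in> Pow T" for S
    using that by (intro mult_nonneg_nonneg cycle_expansion_nonneg[OF ceT]) auto
  show "(\<Sum>S\<in>Pow T. if card (G \<union> S) + 1 = j \<and> card (G \<union> (T - S)) = j + 1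
          then \<mu> (G \<union> S) * \<mu> (G \<union> (T - S)) else 0) \<le>
        (\<Sum>S\<in>Pow T. if card (G \<union> S) = j \<and> card (G \<union> (T - S)) = j
          then card (G \<union> S - (G \<union> (T - S))) / (card (G \<union> S - (G \<union> (T - S))) + 1) *
            (\<mu> (G \<union> S) * \<mu> (G \<union> (T - S))) else 0)"
  proof (cases "card G < j \<and> card T = 2 * (j - card G)")
    case True
    define k where "k = j - card G"
    have k: "1 \<le> k" "card T = 2 * k" "j = card G + k" using True by (auto simp: k_def)
    have l: "(\<Sum>S\<in>Pow T. if card G + card S + 1 = j \<and> card G + (card T - card S) = j + 1
          then \<nu> S * \<nu> (T - S) else 0) = complementary_sum \<nu> T (k - 1)"
      unfolding complementary_sum_Pow[OF fin(2)] using k by (intro sum.cong refl if_cong) auto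
    have r: "(\<Sum>S\<in>Pow T. if card G + card S = j \<and> card G + (card T - card S) = j
          then card S / (card S + 1) * (\<nu> S * \<nu> (T - S)) else 0) = k / (k + 1) * complementary_sum \<nu> T k"
      unfolding complementary_sum_Pow[OF fin(2)] sum_distrib_left using k by (intro sum.cong refl) auto
    have "real (k + 1) * complementary_sum \<nu> T (k - 1) \<le> real k * complementary_sum \<nu> T k"
      using complementary_sum_step[OF fin(2) ceT k(1)] k by simp
    then show ?thesis unfolding lhs rhs l r by (simp add: field_simps)
  next
    \<comment> \<open>For other sizes no pair with this G and T lies on the levels j - 1 and j + 1,
      so the left side is 0.\<close>
    case False
    have "(\<Sum>S\<in>Pow T. if card G + card S + 1 = j \<and> card G + (card T - card S) = j + 1
          then \<nu> S * \<nu> (T - S) else 0) = 0"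
    proof (intro sum.neutral ballI)
      fix S assume "S \<in> Pow T"
      then show "(if card G + card S + 1 = j \<and> card G + (card T - card S) = j + 1
          then \<nu> S * \<nu> (T - S) else 0) = 0" using card_simps(4) False by auto
    qed
    moreover have "0 \<le> (\<Sum>S\<in>Pow T. if card G + card S = j \<and> card G + (card T - card S) = j
          then card S / (card S + 1) * (\<nu> S * \<nu> (T - S)) else 0)"
      by (intro sum_nonneg) (simp add: nn)
    ultimately show ?thesis unfolding lhs rhs by simp
  qed
qed

section \<open>Newton's inequalities for level sums\<close>

lemma sum_Pow_card:
  fixes f :: "nat \<Rightarrow> 'b::semiring_1"
  assumes "finite A"
  shows "(\<Sum>X\<in>Pow A. f (card X)) = (\<Sum>k\<le>card A. of_nat (card A choose k) * f k)"
proof -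
  have "(\<Sum>X\<in>Pow A. f (card X)) = (\<Sum>k\<le>card A. \<Sum>X | X \<in> Pow A \<and> card X = k. f (card X))"
    by (rule sum.group[symmetric]) (use assms card_mono in auto)
  also have "\<dots> = (\<Sum>k\<le>card A. of_nat (card A choose k) * f k)"
    using n_subsets[OF assms] by (intro sum.cong refl) simp
  finally show ?thesis .
qed

text \<open>The kernel is a tensor power of the 2 x 2 matrix with diagonal entries 1 and
  off-diagonal entries t, which is positive semidefinite for t between 0 and 1. Each induction step
  splits off one tensor factor.\<close>

lemma sum_power_symdiff_nonneg:
  fixes x :: "'a set \<Rightarrow> real"
  assumes "finite V" "0 \<le> t" "t \<le> 1"
  shows "0 \<le> (\<Sum>a\<in>Pow V. \<Sum>b\<in>Pow V. x a * x b * t ^ card ((a - b) \<union> (b - a)))"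
  using assms(1)
proof (induction V arbitrary: x rule: finite_induct)
  case (insert i V)
  let ?d = "\<lambda>a b. card ((a - b) \<union> (b - a))"
  let ?Q = "\<lambda>y z. \<Sum>a\<in>Pow V. \<Sum>b\<in>Pow V. y a * z b * t ^ ?d a b"
  define z where "z a = x (insert i a)" for a
  have d: "?d (insert i a) (insert i b) = ?d a b" "?d a (insert i b) = Suc (?d a b)"
    "?d (insert i a) b = Suc (?d a b)" if "a \<in> Pow V" "b \<in> Pow V" for a b
  proof -
    have i: "i \<notin> a" "i \<notin> b" and fin: "finite ((a - b) \<union> (b - a))"
      using that insert.hyps by (auto intro: finite_subset[OF _ insert.hyps(1)])
    have "insert i a - insert i b = a - b" "insert i b - insert i a = b - a"
      "(a - insert i b) \<union> (insert i b - a) = insert i ((a - b) \<union> (b - a))"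
      "(insert i a - b) \<union> (b - insert i a) = insert i ((a - b) \<union> (b - a))" using i by auto
    then show "?d (insert i a) (insert i b) = ?d a b" "?d a (insert i b) = Suc (?d a b)"
      "?d (insert i a) b = Suc (?d a b)" using i fin by simp_all
  qed
  have cross: "(\<Sum>a\<in>Pow V. \<Sum>b\<in>Pow V. y a * u b * t ^ Suc (?d a b)) = t * ?Q y u" for y u
    unfolding sum_distrib_left by (intro sum.cong refl) simp
  have "(\<Sum>a\<in>Pow (insert i V). \<Sum>b\<in>Pow (insert i V). x a * x b * t ^ ?d a b) =
      ?Q x x + t * ?Q z x + (t * ?Q x z + ?Q z z)"
    unfolding sum_Pow_insert[OF insert.hyps] sum.distrib cross[symmetric]
    by (intro arg_cong2[where f = "(+)"] sum.cong refl) (simp_all only: d z_def)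
  \<comment> \<open>The 2 x 2 factor is (1 - t) times the identity plus t times the all-ones matrix,
    so the form becomes a nonnegative combination of forms on V.\<close>
  also have "\<dots> = (1 - t) * (?Q x x + ?Q z z) + t * ?Q (\<lambda>a. x a + z a) (\<lambda>a. x a + z a)"
    by (simp add: algebra_simps sum.distrib)
  also have "\<dots> \<ge> 0"
    using assms insert.IH by (intro add_nonneg_nonneg mult_nonneg_nonneg) auto
  finally show ?case .
qed simp

text \<open>For sets of equal size the symmetric difference has 2 * card (a - b) elements, so
  \<open>sum_power_symdiff_nonneg\<close> covers the kernel t ^ (2 * card (a - b)). Integration over
  [0, 1] is carried out through the antiderivative \<open>F\<close>, which increases because its
  derivative is \<open>t * Q t\<close>.\<close>

lemma sum_inverse_distance_nonneg:
  fixes x :: "'a set \<Rightarrow> real"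
  assumes "finite V"
  shows "0 \<le> (\<Sum>a | a \<subseteq> V \<and> card a = j. \<Sum>b | b \<subseteq> V \<and> card b = j. x a * x b / (card (a - b) + 1))"
proof -
  let ?L = "{a. a \<subseteq> V \<and> card a = j}"
  define F where "F t = (\<Sum>a\<in>?L. \<Sum>b\<in>?L. x a * x b / (card (a - b) + 1) * (t ^ (2 * (card (a - b) + 1)) / 2))"
    for t :: real
  define Q where "Q t = (\<Sum>a\<in>?L. \<Sum>b\<in>?L. x a * x b * t ^ (2 * card (a - b)))" for t :: real
  have Q: "0 \<le> Q t" if t: "0 \<le> t" "t \<le> 1" for t
  proof -
    \<comment> \<open>Extending x by 0 off level j gives a form on the whole power set.\<close>
    let ?y = "\<lambda>a. if card a = j then x a else 0"
    have eq: "2 * card (a - b) = card ((a - b) \<union> (b - a))" if "a \<in> ?L" "b \<in> ?L" for a b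
    proof -
      have fin: "finite a" "finite b" using that assms by (auto intro: finite_subset[OF _ assms])
      have "card (a - b) + card (a \<inter> b) = j" "card (b - a) + card (a \<inter> b) = j"
        using that fin card_Int_Diff[of a b] card_Int_Diff[of b a] by (simp_all add: Int_commute)
      moreover have "card ((a - b) \<union> (b - a)) = card (a - b) + card (b - a)"
        using fin by (intro card_Un_disjoint) auto
      ultimately show ?thesis by simp
    qed
    have filt: "(\<Sum>a\<in>?L. k a) = (\<Sum>a\<in>Pow V. if card a = j then k a else 0)" for k :: "'a set \<Rightarrow> real"
      by (subst sum.inter_filter[symmetric]) (use assms in \<open>auto intro: sum.cong\<close>)
    have "Q t = (\<Sum>a\<in>?L. \<Sum>b\<in>?L. x a * x b * t ^ card ((a - b) \<union> (b - a)))"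
      unfolding Q_def by (intro sum.cong refl) (simp only: eq)
    also have "\<dots> = (\<Sum>a\<in>Pow V. \<Sum>b\<in>Pow V. ?y a * ?y b * t ^ card ((a - b) \<union> (b - a)))"
      unfolding filt by (intro sum.cong refl) (auto intro!: sum.cong)
    also have "\<dots> \<ge> 0" by (rule sum_power_symdiff_nonneg[OF assms t])
    finally show ?thesis .
  qed
  \<comment> \<open>The kernel is \<open>2 \<integral> t ^ (2 * card (a - b) + 1) dt\<close> over \<open>[0, 1]\<close>.\<close>
  have "F 0 \<le> F 1"
  proof (rule DERIV_nonneg_imp_nondecreasing[where f = F])
    fix t :: real assume t: "0 \<le> t" "t \<le> 1"
    have "DERIV F t :> (\<Sum>a\<in>?L. \<Sum>b\<in>?L. x a * x b / (card (a - b) + 1) *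
        (real (2 * (card (a - b) + 1)) * t ^ (2 * (card (a - b) + 1) - Suc 0) / 2))"
      unfolding F_def by (intro DERIV_sum DERIV_cmult DERIV_cdivide DERIV_pow)
    also have "(\<Sum>a\<in>?L. \<Sum>b\<in>?L. x a * x b / (card (a - b) + 1) *
        (real (2 * (card (a - b) + 1)) * t ^ (2 * (card (a - b) + 1) - Suc 0) / 2)) = t * Q t"
      unfolding Q_def sum_distrib_left
      by (intro sum.cong refl) (simp add: divide_simps)
    finally show "\<exists>y. DERIV F t :> y \<and> 0 \<le> y" using Q[OF t] t by auto
  qed simp
  moreover have "F 0 = 0" by (simp add: F_def)
  moreover have "F 1 = (\<Sum>a\<in>?L. \<Sum>b\<in>?L. x a * x b / (card (a - b) + 1)) / 2"
    unfolding F_def sum_divide_distrib by (intro sum.cong refl) simp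
  ultimately show ?thesis by simp
qed

text \<open>With k the size of the intersection, there are (j choose k) * (card V - j choose j - k)
  sets b, each of weight 1 / (j - k + 1). Absorbing the denominator into the first binomial
  coefficient leaves a Vandermonde sum.\<close>

lemma sum_inverse_distance:
  assumes "finite V" "a \<subseteq> V" "card a = j"
  shows "(\<Sum>b | b \<subseteq> V \<and> card b = j. 1 / (card (a - b) + 1)) = real (Suc (card V) choose j) / Suc j"
proof -
  have fa: "finite a" using assms finite_subset by blast
  have "(\<Sum>b | b \<subseteq> V \<and> card b = j. 1 / (card (a - b) + 1)) =
      (\<Sum>(X, Y)\<in>Sigma (Pow a) (\<lambda>X. {Y. Y \<subseteq> V - a \<and> card Y = j - card X}). 1 / real (j - card X + 1))"
  proof (rule sum.reindex_bij_witness[of _ "\<lambda>(X, Y). X \<union> Y" "\<lambda>b. (a \<inter> b, b - a)"])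
    fix b assume b: "b \<in> {b. b \<subseteq> V \<and> card b = j}"
    have fb: "finite b" using b assms(1) finite_subset by blast
    have 1: "card (a \<inter> b) + card (b - a) = j" "card (a \<inter> b) + card (a - b) = j"
      using b assms(3) fa fb card_Int_Diff[of a b] card_Int_Diff[of b a] by (simp_all add: Int_commute)
    then show "(a \<inter> b, b - a) \<in> Sigma (Pow a) (\<lambda>X. {Y. Y \<subseteq> V - a \<and> card Y = j - card X})"
      using b by auto
    show "(case (a \<inter> b, b - a) of (X, Y) \<Rightarrow> X \<union> Y) = b" by auto
    show "(case (a \<inter> b, b - a) of (X, Y) \<Rightarrow> 1 / real (j - card X + 1)) = 1 / (card (a - b) + 1)"
      using 1(2) by auto
  next
    fix z assume "z \<in> Sigma (Pow a) (\<lambda>X. {Y. Y \<subseteq> V - a \<and> card Y = j - card X})"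
    then obtain X Y where z: "z = (X, Y)" "X \<subseteq> a" "Y \<subseteq> V - a" "card Y = j - card X" by auto
    have "finite X" "finite Y" using z fa assms(1) by (meson finite_Diff finite_subset)+
    then have "card (X \<union> Y) = card X + card Y" using z by (intro card_Un_disjoint) auto
    moreover have "card X \<le> j" using z fa assms(3) card_mono by blast
    ultimately show "(case z of (X, Y) \<Rightarrow> X \<union> Y) \<in> {b. b \<subseteq> V \<and> card b = j}"
      using z assms(2) by auto
    have "a \<inter> (X \<union> Y) = X" "X \<union> Y - a = Y" using z by auto
    then show "(a \<inter> (case z of (X, Y) \<Rightarrow> X \<union> Y), (case z of (X, Y) \<Rightarrow> X \<union> Y) - a) = z"
      by (simp add: z(1))
  qed
  also have "\<dots> = (\<Sum>X\<in>Pow a. \<Sum>Y | Y \<subseteq> V - a \<and> card Y = j - card X. 1 / real (j - card X + 1))"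
    by (rule sum.Sigma[symmetric]) (use assms fa in auto)
  also have "\<dots> = (\<Sum>X\<in>Pow a. real ((card V - j) choose (j - card X)) / real (j - card X + 1))"
    using assms fa by (simp add: n_subsets card_Diff_subset)
  also have "\<dots> = (\<Sum>k\<le>j. real (j choose k) * (real ((card V - j) choose (j - k)) / real (j - k + 1)))"
    using sum_Pow_card[OF fa, of "\<lambda>k. real ((card V - j) choose (j - k)) / real (j - k + 1)"] assms(3)
    by simp
  \<comment> \<open>Absorption: (j choose k) / (j - k + 1) = (j + 1 choose k) / (j + 1).\<close>
  also have "\<dots> = (\<Sum>k\<le>j. real ((Suc j choose k) * ((card V - j) choose (j - k))) / Suc j)"
  proof (intro sum.cong refl)
    fix k assume "k \<in> {..j}"
    then have k: "k \<le> j" by simp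
    have "Suc j * (j choose (j - k)) = (Suc j choose Suc (j - k)) * Suc (j - k)"
      by (rule Suc_times_binomial_eq)
    moreover have "j choose (j - k) = j choose k" using k by (simp add: binomial_symmetric[of k j])
    moreover have "Suc j choose Suc (j - k) = Suc j choose k"
      using k binomial_symmetric[of k "Suc j"] by (simp add: Suc_diff_le)
    ultimately have "real (Suc j) * real (j choose k) = real (Suc j choose k) * real (j - k + 1)"
      by (metis Suc_eq_plus1 of_nat_mult)
    then have "real (j choose k) / real (j - k + 1) = real (Suc j choose k) / Suc j"
      by (simp add: divide_simps mult.commute del: of_nat_Suc)
    then show "real (j choose k) * (real ((card V - j) choose (j - k)) / real (j - k + 1)) =
        real ((Suc j choose k) * ((card V - j) choose (j - k))) / Suc j"
      by (simp add: field_simps del: of_nat_Suc binomial_Suc_Suc)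
  qed
  also have "\<dots> = real (\<Sum>k\<le>j. (Suc j choose k) * ((card V - j) choose (j - k))) / Suc j"
    by (simp only: of_nat_sum sum_divide_distrib)
  also have "(\<Sum>k\<le>j. (Suc j choose k) * ((card V - j) choose (j - k))) = Suc (card V) choose j"
    using vandermonde[of "Suc j" "card V - j" j] card_mono[OF assms(1,2)] assms(3)
    by (simp del: binomial_Suc_Suc)
  finally show ?thesis .
qed

section \<open>Newton's inequality for cycle expansions\<close>

text \<open>The value type is general since level sums of real, complex and polynomial valued
  functions occur.\<close>

definition level_sum :: "('a set \<Rightarrow> 'b::comm_monoid_add) \<Rightarrow> 'a set \<Rightarrow> nat \<Rightarrow> 'b" where
  "level_sum \<mu> V j = (\<Sum>a | a \<subseteq> V \<and> card a = j. \<mu> a)"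

text \<open>Equal row sums r make the all-ones vector an eigenvector of the kernel. Positivity of
  the form at \<open>\<mu>\<close> minus its mean \<open>M\<close> then bounds the form at
  \<open>\<mu>\<close> below by r / N times the square of the level sum, and r / N is the constant
  in question.\<close>

lemma level_sum_square_le:
  fixes \<mu> :: "'a set \<Rightarrow> real"
  assumes "finite V" "j < card V"
  shows "(level_sum \<mu> V j)\<^sup>2 * (real (card V + 1) / (real (j + 1) * real (card V - j + 1))) \<le>
    (\<Sum>a | a \<subseteq> V \<and> card a = j. \<Sum>b | b \<subseteq> V \<and> card b = j. \<mu> a * \<mu> b / (card (a - b) + 1))"
proof -
  let ?L = "{a. a \<subseteq> V \<and> card a = j}"
  define n where "n = card V"
  define N where "N = real (n choose j)"
  define r where "r = real (Suc n choose j) / Suc j"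
  define M where "M = level_sum \<mu> V j / N"
  let ?K = "\<lambda>a b. 1 / real (card (a - b) + 1)"
  have N: "N > 0" using assms(2) by (simp add: N_def n_def zero_less_binomial)
  have cL: "real (card ?L) = N" using n_subsets[OF assms(1)] by (simp add: N_def n_def)
  have row: "(\<Sum>b\<in>?L. ?K a b) = r" if "a \<in> ?L" for a
    using sum_inverse_distance[OF assms(1), of a j] that by (simp add: r_def n_def)
  \<comment> \<open>Sets of equal size satisfy card (a - b) = card (b - a), so column sums agree
    with row sums.\<close>
  have sym: "?K a b = ?K b a" if "a \<in> ?L" "b \<in> ?L" for a b
  proof -
    have "finite a" "finite b" using that assms(1) by (auto intro: finite_subset[OF _ assms(1)])
    then have "card (a - b) = card (b - a)"
      using that card_le_sym_Diff[of a b] card_le_sym_Diff[of b a] by simp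
    then show ?thesis by simp
  qed
  have col: "(\<Sum>a\<in>?L. ?K a b) = r" if "b \<in> ?L" for b
    using row[OF that] sym that by (metis (mono_tags, lifting) sum.cong)
  have "0 \<le> (\<Sum>a\<in>?L. \<Sum>b\<in>?L. (\<mu> a - M) * (\<mu> b - M) / (card (a - b) + 1))"
    by (rule sum_inverse_distance_nonneg[OF assms(1)])
  also have "\<dots> = (\<Sum>a\<in>?L. \<Sum>b\<in>?L. \<mu> a * \<mu> b / (card (a - b) + 1) - M * (\<mu> a * ?K a b)
      - M * (\<mu> b * ?K a b) + M * M * ?K a b)"
    by (intro sum.cong refl) (simp add: divide_simps, simp add: algebra_simps)
  also have "\<dots> = (\<Sum>a\<in>?L. \<Sum>b\<in>?L. \<mu> a * \<mu> b / (card (a - b) + 1))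
      - M * (\<Sum>a\<in>?L. \<Sum>b\<in>?L. \<mu> a * ?K a b)
      - M * (\<Sum>b\<in>?L. \<Sum>a\<in>?L. \<mu> b * ?K a b) + M * M * (\<Sum>a\<in>?L. \<Sum>b\<in>?L. ?K a b)"
    by (subst (3) sum.swap) (simp only: sum.distrib sum_subtractf sum_distrib_left)
  also have "(\<Sum>a\<in>?L. \<Sum>b\<in>?L. ?K a b) = N * r"
    using row by (simp add: cL flip: cL)
  also have "(\<Sum>a\<in>?L. \<Sum>b\<in>?L. \<mu> a * ?K a b) = level_sum \<mu> V j * r"
    unfolding level_sum_def sum_distrib_right sum_distrib_left[symmetric]
    by (intro sum.cong refl) (simp only: row)
  also have "(\<Sum>b\<in>?L. \<Sum>a\<in>?L. \<mu> b * ?K a b) = level_sum \<mu> V j * r"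
    unfolding level_sum_def sum_distrib_right sum_distrib_left[symmetric]
    by (intro sum.cong refl) (simp only: col)
  also have "(\<Sum>a\<in>?L. \<Sum>b\<in>?L. \<mu> a * \<mu> b / (card (a - b) + 1))
      - M * (level_sum \<mu> V j * r) - M * (level_sum \<mu> V j * r) + M * M * (N * r) =
      (\<Sum>a\<in>?L. \<Sum>b\<in>?L. \<mu> a * \<mu> b / (card (a - b) + 1)) - (level_sum \<mu> V j)\<^sup>2 * (r / N)"
    using N by (simp add: M_def field_simps power2_eq_square)
  also have "r / N = real (n + 1) / (real (j + 1) * real (n - j + 1))"
  proof -
    have "Suc (n - j) * (Suc n choose j) = Suc n * (n choose j)"
      using assms(2) Suc_times_binomial_eq[of n "n - j"] binomial_symmetric[of j n]
        binomial_symmetric[of j "Suc n"] by (simp add: n_def Suc_diff_le mult.commute)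
    then have "real (n - j + 1) * real (Suc n choose j) = real (n + 1) * N"
      unfolding N_def by (metis Suc_eq_plus1 of_nat_mult)
    then show ?thesis using N unfolding r_def
      by (simp add: divide_simps mult.commute del: of_nat_Suc binomial_Suc_Suc of_nat_add)
  qed
  finally show ?thesis by (simp add: n_def)
qed

text \<open>With k = card (a - b), the adjacent product is at most the sum of k / (k + 1) *
  \<open>\<mu> a * \<mu> b\<close> over level j. As k / (k + 1) = 1 - 1 / (k + 1), this is the
  square of the level sum minus the form that \<open>level_sum_square_le\<close> bounds
  below.\<close>

lemma newton_level_sum:
  assumes fV: "finite V" and ce: "cycle_expansion V \<mu>" and j: "1 \<le> j" "j < card V"
  shows "real (j + 1) * real (card V - j + 1) * (level_sum \<mu> V (j - 1) * level_sum \<mu> V (j + 1))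
    \<le> real j * real (card V - j) * (level_sum \<mu> V j)\<^sup>2"
proof -
  let ?L = "\<lambda>j. {a. a \<subseteq> V \<and> card a = j}"
  let ?n = "card V" and ?E = "level_sum \<mu> V"
  have filt: "(\<Sum>a\<in>?L j. k a) = (\<Sum>a\<in>Pow V. if card a = j then k a else 0)" for k :: "'a set \<Rightarrow> real" and j
    by (subst sum.inter_filter[symmetric]) (use fV in \<open>auto intro: sum.cong\<close>)
  have filt2: "(\<Sum>a\<in>?L i. \<Sum>b\<in>?L j. k a b) = (\<Sum>a\<in>Pow V. \<Sum>b\<in>Pow V. if card a = i \<and> card b = j then k a b else 0)"
    for k :: "'a set \<Rightarrow> 'a set \<Rightarrow> real" and i j
    unfolding filt by (intro sum.cong refl) (auto intro!: sum.cong)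
  have "?E (j - 1) * ?E (j + 1) = (\<Sum>a\<in>?L (j - 1). \<Sum>b\<in>?L (j + 1). \<mu> a * \<mu> b)"
    unfolding level_sum_def by (rule sum_product)
  also have "\<dots> = (\<Sum>a\<in>Pow V. \<Sum>b\<in>Pow V. if card a + 1 = j \<and> card b = j + 1 then \<mu> a * \<mu> b else 0)"
    unfolding filt2 using j(1) by (intro sum.cong refl) auto
  also have "\<dots> \<le> (\<Sum>a\<in>?L j. \<Sum>b\<in>?L j. card (a - b) / (card (a - b) + 1) * (\<mu> a * \<mu> b))"
    unfolding filt2 by (rule sum_adjacent_levels_le[OF fV ce])
  also have "\<dots> = (\<Sum>a\<in>?L j. \<Sum>b\<in>?L j. \<mu> a * \<mu> b) - (\<Sum>a\<in>?L j. \<Sum>b\<in>?L j. \<mu> a * \<mu> b / (card (a - b) + 1))"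
    unfolding sum_subtractf[symmetric] by (intro sum.cong refl) (simp add: field_simps)
  also have "(\<Sum>a\<in>?L j. \<Sum>b\<in>?L j. \<mu> a * \<mu> b) = (?E j)\<^sup>2"
    unfolding level_sum_def power2_eq_square by (rule sum_product[symmetric])
  finally have "?E (j - 1) * ?E (j + 1) \<le> (?E j)\<^sup>2 - (?E j)\<^sup>2 * (real (?n + 1) / (real (j + 1) * real (?n - j + 1)))"
    using level_sum_square_le[OF fV j(2), of \<mu>] by linarith
  \<comment> \<open>With n = card V, this evaluates the numerator of 1 - (n + 1) / ((j + 1) * (n - j
    + 1)).\<close>
  moreover have "real (j + 1) * real (?n - j + 1) - real (?n + 1) = real j * real (?n - j)"
    using j by (simp add: of_nat_diff algebra_simps)
  ultimately show ?thesis
    by (simp add: divide_simps del: of_nat_add of_nat_Suc) (simp add: algebra_simps)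
qed

section \<open>Principal minors\<close>

text \<open>The Leibniz formula over an arbitrary index set: unlike with \<open>submatrix\<close>,
  adding or deleting an index renumbers nothing.\<close>

definition pminor :: "('a \<Rightarrow> 'a \<Rightarrow> 'b::comm_ring_1) \<Rightarrow> 'a set \<Rightarrow> 'b" where
  "pminor A S = (\<Sum>p | p permutes S. of_int (sign p) * (\<Prod>i\<in>S. A i (p i)))"

lemma pminor_cong:
  assumes "\<And>i j. i \<in> S \<Longrightarrow> j \<in> S \<Longrightarrow> A i j = B i j"
  shows "pminor A S = pminor B S"
  unfolding pminor_def
  by (intro sum.cong refl arg_cong2[where f = "(*)"] prod.cong assms) (auto simp: permutes_in_image)

text \<open>A permutation of \<open>insert a S\<close> is \<open>transpose a b\<close> after a
  permutation q of S, where b is the image of a. For b = a the index a is fixed. Otherwise the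
  transposition flips the sign and redirects the value b of q to a, which replaces column b by
  column a.\<close>

lemma pminor_insert:
  assumes "finite S" "a \<notin> S"
  shows "pminor A (insert a S) =
    A a a * pminor A S - (\<Sum>b\<in>S. A a b * pminor (\<lambda>i j. A i (if j = b then a else j)) S)"
proof -
  define f where "f p = of_int (sign p) * (\<Prod>i\<in>insert a S. A i (p i))" for p
  have fixed: "q a = a" if "q permutes S" for q using that assms(2) by (rule permutes_not_in)
  have diag: "(\<Sum>q | q permutes S. f (transpose a a \<circ> q)) = A a a * pminor A S"
    unfolding pminor_def sum_distrib_left
    by (intro sum.cong refl) (simp add: f_def assms fixed ac_simps)
  have off: "(\<Sum>q | q permutes S. f (transpose a b \<circ> q)) =
      - (A a b * pminor (\<lambda>i j. A i (if j = b then a else j)) S)" if b: "b \<in> S" for b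
    unfolding pminor_def sum_distrib_left sum_negf[symmetric]
  proof (intro sum.cong refl)
    fix q assume "q \<in> {q. q permutes S}"
    then have q: "q permutes S" by simp
    have ab: "a \<noteq> b" using b assms(2) by blast
    have "permutation q" using q assms(1) permutation_permutes by blast
    then have sgn: "sign (transpose a b \<circ> q) = - sign q"
      by (simp add: sign_compose permutation_swap_id sign_swap_id ab)
    have "(\<Prod>i\<in>S. A i ((transpose a b \<circ> q) i)) = (\<Prod>i\<in>S. A i (if q i = b then a else q i))"
    proof (intro prod.cong refl)
      fix i assume "i \<in> S"
      then have "q i \<noteq> a" using permutes_in_image[OF q] assms(2) by auto
      then show "A i ((transpose a b \<circ> q) i) = A i (if q i = b then a else q i)"
        by (simp add: transpose_def)
    qed
    then show "f (transpose a b \<circ> q) =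
        - (A a b * (of_int (sign q) * (\<Prod>i\<in>S. A i (if q i = b then a else q i))))"
      unfolding f_def sgn using assms fixed[OF q] by simp
  qed
  have "pminor A (insert a S) = (\<Sum>b\<in>insert a S. \<Sum>q | q permutes S. f (transpose a b \<circ> q))"
    unfolding pminor_def f_def[symmetric] by (rule sum_over_permutations_insert[OF assms])
  also have "\<dots> = A a a * pminor A S + (\<Sum>b\<in>S. \<Sum>q | q permutes S. f (transpose a b \<circ> q))"
    by (simp only: sum.insert[OF assms] diag)
  also have "(\<Sum>b\<in>S. \<Sum>q | q permutes S. f (transpose a b \<circ> q)) =
      (\<Sum>b\<in>S. - (A a b * pminor (\<lambda>i j. A i (if j = b then a else j)) S))"
    by (intro sum.cong refl off)
  finally show ?thesis by (simp add: sum_negf)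
qed

text \<open>The sum, over all paths from \<open>b\<close> to \<open>i\<close> that visit exactly the vertices in \<open>D\<close> in between, of
  the products of the negated entries along the path.\<close>

function path_weight :: "('a \<Rightarrow> 'a \<Rightarrow> real) \<Rightarrow> 'a \<Rightarrow> 'a \<Rightarrow> 'a set \<Rightarrow> real" where
  "path_weight A i b D = (if finite D \<and> D \<noteq> {}
     then (\<Sum>c\<in>D. - A b c * path_weight A i c (D - {c})) else - A b i)"
  by auto
termination
  by (relation "measure (\<lambda>(A, i, b, D). card D)") (auto simp: card_gt_0_iff)

declare path_weight.simps [simp del]

text \<open>Start and end may coincide, which is the case of cycles. The entry from b to i is then
  diagonal and of unknown sign, but it enters only for empty D; hence the conditional last
  hypothesis.\<close>

lemma path_weight_nonneg:
  assumes "finite D"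
    and "\<And>c. c \<in> D \<Longrightarrow> A b c \<le> 0" "\<And>c d. c \<in> D \<Longrightarrow> d \<in> D \<Longrightarrow> c \<noteq> d \<Longrightarrow> A c d \<le> 0"
    and "\<And>c. c \<in> D \<Longrightarrow> A c i \<le> 0" "D = {} \<Longrightarrow> A b i \<le> 0"
  shows "0 \<le> path_weight A i b D"
  using assms
proof (induction "card D" arbitrary: b D)
  case 0
  then show ?case by (simp add: path_weight.simps)
next
  case (Suc n)
  have "0 \<le> - A b c * path_weight A i c (D - {c})" if c: "c \<in> D" for c
  proof (intro mult_nonneg_nonneg)
    show "0 \<le> - A b c" using Suc.prems(2)[OF c] by simp
    show "0 \<le> path_weight A i c (D - {c})"
      using Suc.hyps(2) Suc.prems c by (intro Suc.hyps(1)) auto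
  qed
  then show ?case
    using Suc.prems(1,5) by (subst path_weight.simps) (auto intro: sum_nonneg)
qed

lemma sum_elements_Pow:
  fixes h :: "'a \<Rightarrow> 'a set \<Rightarrow> 'b::comm_monoid_add"
  assumes "finite S"
  shows "(\<Sum>c\<in>S. \<Sum>D\<in>Pow (S - {c}). h c D) = (\<Sum>E\<in>Pow S. \<Sum>c\<in>E. h c (E - {c}))"
proof -
  have fin: "\<And>E. E \<in> Pow S \<Longrightarrow> finite E" using assms by (auto intro: finite_subset[OF _ assms])
  have "(\<Sum>c\<in>S. \<Sum>D\<in>Pow (S - {c}). h c D) = (\<Sum>(c, D)\<in>Sigma S (\<lambda>c. Pow (S - {c})). h c D)"
    by (rule sum.Sigma) (use assms in auto)
  also have "\<dots> = (\<Sum>(E, c)\<in>Sigma (Pow S) (\<lambda>E. E). h c (E - {c}))"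
    by (rule sum.reindex_bij_witness[of _ "\<lambda>(E, c). (c, E - {c})" "\<lambda>(c, D). (insert c D, c)"])
       (auto simp: Diff_insert_absorb subset_Diff_insert)
  also have "\<dots> = (\<Sum>E\<in>Pow S. \<Sum>c\<in>E. h c (E - {c}))"
    by (rule sum.Sigma[symmetric]) (use assms fin in auto)
  finally show ?thesis .
qed

text \<open>A path from b to i is split at its first edge, which leads to i directly or to some c in
  S, from where \<open>ent\<close> describes the rest. The start b is free, so that the lemma serves
  both open paths and, with b = i, cycles.\<close>

lemma pminor_first_step:
  fixes A :: "'a \<Rightarrow> 'a \<Rightarrow> real"
  assumes "finite S"
    and ent: "\<And>c. c \<in> S \<Longrightarrow> - pminor (\<lambda>k j. A k (if j = c then i else j)) S =
        (\<Sum>D\<in>Pow (S - {c}). path_weight A i c D * pminor A (S - {c} - D))"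
  shows "- A b i * pminor A S + (\<Sum>c\<in>S. A b c * pminor (\<lambda>k j. A k (if j = c then i else j)) S) =
    (\<Sum>D\<in>Pow S. path_weight A i b D * pminor A (S - D))"
proof -
  have "(\<Sum>c\<in>S. A b c * pminor (\<lambda>k j. A k (if j = c then i else j)) S) =
      (\<Sum>c\<in>S. \<Sum>D\<in>Pow (S - {c}). - A b c * path_weight A i c D * pminor A (S - insert c D))"
  proof (intro sum.cong refl)
    fix c assume c: "c \<in> S"
    have "A b c * pminor (\<lambda>k j. A k (if j = c then i else j)) S =
        - A b c * (- pminor (\<lambda>k j. A k (if j = c then i else j)) S)" by simp
    also have "\<dots> = (\<Sum>D\<in>Pow (S - {c}). - A b c * (path_weight A i c D * pminor A (S - {c} - D)))"
      unfolding ent[OF c] by (rule sum_distrib_left)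
    also have "\<dots> = (\<Sum>D\<in>Pow (S - {c}). - A b c * path_weight A i c D * pminor A (S - insert c D))"
    proof (intro sum.cong refl)
      fix D
      have "S - {c} - D = S - insert c D" by blast
      then show "- A b c * (path_weight A i c D * pminor A (S - {c} - D)) =
          - A b c * path_weight A i c D * pminor A (S - insert c D)" by simp
    qed
    finally show "A b c * pminor (\<lambda>k j. A k (if j = c then i else j)) S = \<dots>" .
  qed
  also have "\<dots> = (\<Sum>D\<in>Pow S. \<Sum>c\<in>D. - A b c * path_weight A i c (D - {c}) * pminor A (S - insert c (D - {c})))"
    by (rule sum_elements_Pow[OF assms(1)])
  also have "\<dots> = (\<Sum>D\<in>Pow S. (\<Sum>c\<in>D. - A b c * path_weight A i c (D - {c})) * pminor A (S - D))"
    unfolding sum_distrib_right by (intro sum.cong refl) (simp add: insert_absorb)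
  also have "\<dots> = (\<Sum>D\<in>Pow S - {{}}. (\<Sum>c\<in>D. - A b c * path_weight A i c (D - {c})) * pminor A (S - D))"
    using assms(1) by (intro sum.mono_neutral_right) auto
  also have "\<dots> = (\<Sum>D\<in>Pow S - {{}}. path_weight A i b D * pminor A (S - D))"
  proof (intro sum.cong refl)
    fix D assume "D \<in> Pow S - {{}}"
    then have "finite D" "D \<noteq> {}" using assms(1) by (auto intro: finite_subset[OF _ assms(1)])
    then have "path_weight A i b D = (\<Sum>c\<in>D. - A b c * path_weight A i c (D - {c}))"
      by (subst path_weight.simps) simp
    then show "(\<Sum>c\<in>D. - A b c * path_weight A i c (D - {c})) * pminor A (S - D) =
        path_weight A i b D * pminor A (S - D)" by simp
  qed
  finally have "- A b i * pminor A S + (\<Sum>c\<in>S. A b c * pminor (\<lambda>k j. A k (if j = c then i else j)) S) =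
      path_weight A i b {} * pminor A (S - {}) + (\<Sum>D\<in>Pow S - {{}}. path_weight A i b D * pminor A (S - D))"
    by (simp add: path_weight.simps[of A i b "{}"])
  also have "\<dots> = (\<Sum>D\<in>Pow S. path_weight A i b D * pminor A (S - D))"
    using assms(1) by (intro sum.remove[symmetric]) auto
  finally show ?thesis .
qed

text \<open>Expanding at b produces the edge from b to i and, for each other c, an edge from b to c
  times the same kind of minor on S - {b}; the induction thus follows the path one vertex at a
  time.\<close>

lemma pminor_column_replaced:
  fixes A :: "'a \<Rightarrow> 'a \<Rightarrow> real"
  assumes "finite S" "b \<in> S" "i \<notin> S"
  shows "- pminor (\<lambda>k j. A k (if j = b then i else j)) S =
    (\<Sum>D\<in>Pow (S - {b}). path_weight A i b D * pminor A (S - {b} - D))"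
  using assms
proof (induction "card S" arbitrary: S b)
  case (Suc n)
  let ?R = "\<lambda>c k j. A k (if j = c then i else j)" and ?S = "S - {b}"
  have S: "S = insert b ?S" "finite ?S" "b \<notin> ?S" "i \<notin> ?S" "i \<noteq> b" using Suc.prems by auto
  have "card ?S = n" using Suc.hyps(2) Suc.prems by simp
  then have IH: "- pminor (?R c) ?S = (\<Sum>D\<in>Pow (?S - {c}). path_weight A i c D * pminor A (?S - {c} - D))"
    if "c \<in> ?S" for c using Suc.hyps(1)[of ?S c] that S by simp
  have "pminor (?R b) (insert b ?S) = ?R b b b * pminor (?R b) ?S -
      (\<Sum>c\<in>?S. ?R b b c * pminor (\<lambda>k j. ?R b k (if j = c then b else j)) ?S)"
    by (rule pminor_insert[OF S(2,3)])
  also have "pminor (?R b) ?S = pminor A ?S" by (rule pminor_cong) auto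
  \<comment> \<open>Column c of the doubly modified matrix is column b of \<open>?R b\<close>, hence
    column i of A, so on \<open>?S\<close> the matrix is \<open>?R c\<close>.\<close>
  also have "(\<Sum>c\<in>?S. ?R b b c * pminor (\<lambda>k j. ?R b k (if j = c then b else j)) ?S) =
      (\<Sum>c\<in>?S. A b c * pminor (?R c) ?S)"
    by (intro sum.cong refl arg_cong2[where f = "(*)"] pminor_cong) auto
  finally have "- pminor (?R b) (insert b ?S) = - A b i * pminor A ?S + (\<Sum>c\<in>?S. A b c * pminor (?R c) ?S)"
    by simp
  also have "\<dots> = (\<Sum>D\<in>Pow ?S. path_weight A i b D * pminor A (?S - D))"
    by (rule pminor_first_step[OF S(2) IH])
  finally show ?case using S(1) by metis
qed auto

lemma cycle_expansion_pminor:
  fixes A :: "'a \<Rightarrow> 'a \<Rightarrow> real"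
  assumes "finite V" "\<And>S. S \<subseteq> V \<Longrightarrow> 0 \<le> pminor A S"
    and off: "\<And>i j. i \<in> V \<Longrightarrow> j \<in> V \<Longrightarrow> i \<noteq> j \<Longrightarrow> A i j \<le> 0"
  shows "cycle_expansion V (pminor A)"
proof (rule cycle_expansionI)
  fix i assume i: "i \<in> V"
  \<comment> \<open>\<open>cycle_expansion\<close> asks for nonnegative weights at all nonempty D;
    outside V - {i}, where the signs of A give no control, the weight is set to 0.\<close>
  define w where "w D = (if D \<subseteq> V - {i} then path_weight A i i D else 0)" for D
  have "0 \<le> w D" if "D \<noteq> {}" for D
  proof (cases "D \<subseteq> V - {i}")
    case True
    have "finite D" using True assms(1) by (meson finite_Diff finite_subset)
    then have "0 \<le> path_weight A i i D"
      using True i that by (intro path_weight_nonneg) (auto intro!: off)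
    then show ?thesis by (simp add: w_def)
  qed (simp add: w_def)
  moreover have "pminor A (insert i S) = - (\<Sum>D\<in>Pow S. w D * pminor A (S - D))" if S: "S \<subseteq> V - {i}" for S
  proof -
    have S': "finite S" "i \<notin> S" using S assms(1) by (meson finite_Diff finite_subset) (use S in auto)
    have "pminor A (insert i S) = - (- A i i * pminor A S +
        (\<Sum>b\<in>S. A i b * pminor (\<lambda>k j. A k (if j = b then i else j)) S))"
      unfolding pminor_insert[OF S'] by simp
    also have "\<dots> = - (\<Sum>D\<in>Pow S. path_weight A i i D * pminor A (S - D))"
      using pminor_first_step[OF S'(1) pminor_column_replaced[OF S'(1) _ S'(2)]] by simp
    also have "(\<Sum>D\<in>Pow S. path_weight A i i D * pminor A (S - D)) = (\<Sum>D\<in>Pow S. w D * pminor A (S - D))"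
    proof (intro sum.cong refl)
      fix D assume "D \<in> Pow S"
      then have "D \<subseteq> V - {i}" using S by blast
      then show "path_weight A i i D * pminor A (S - D) = w D * pminor A (S - D)" by (simp add: w_def)
    qed
    finally show ?thesis .
  qed
  ultimately show "\<exists>w. (\<forall>D. D \<noteq> {} \<longrightarrow> 0 \<le> w D) \<and>
      (\<forall>S\<subseteq>V - {i}. pminor A (insert i S) = - (\<Sum>D\<in>Pow S. w D * pminor A (S - D)))" by blast
qed (rule assms(2))

section \<open>Transfer to principal minors of matrices\<close>

text \<open>Conjugation by f, as \<open>map_permutation\<close>, is a sign preserving bijection from
  the permutations of T to those of S.\<close>

lemma pminor_bij_betw:
  assumes "bij_betw f T S" "finite T"
  shows "pminor (\<lambda>i j. A (f i) (f j)) T = pminor A S"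
proof -
  have inj: "inj_on f T" and fT: "f ` T = S" using assms(1) by (auto simp: bij_betw_def)
  let ?g = "inv_into T f"
  have g: "bij_betw ?g S T" by (rule bij_betw_inv_into[OF assms(1)])
  have gf: "map_permutation S ?g (map_permutation T f p) = p" if "p permutes T" for p
    by (rule map_permutation_compose_inv[OF assms(1) that]) (simp add: inj)
  have fg: "map_permutation T f (map_permutation S ?g q) = q" if "q permutes S" for q
    by (rule map_permutation_compose_inv[OF g that]) (simp add: f_inv_into_f fT)
  show ?thesis unfolding pminor_def
  proof (rule sum.reindex_bij_witness[of _ "map_permutation S ?g" "map_permutation T f"])
    fix p assume "p \<in> {p. p permutes T}"
    then have p: "p permutes T" by simp
    show "map_permutation S ?g (map_permutation T f p) = p" by (rule gf[OF p])
    show "map_permutation T f p \<in> {p. p permutes S}"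
      using map_permutation_permutes[OF assms(1) p] by simp
    have "(\<Prod>i\<in>S. A i (map_permutation T f p i)) = (\<Prod>i\<in>T. A (f i) (map_permutation T f p (f i)))"
      unfolding fT[symmetric] by (simp add: prod.reindex[OF inj])
    also have "\<dots> = (\<Prod>i\<in>T. A (f i) (f (p i)))"
      by (intro prod.cong refl) (simp add: map_permutation_apply[OF inj])
    finally show "of_int (sign (map_permutation T f p)) * (\<Prod>i\<in>S. A i (map_permutation T f p i)) =
        of_int (sign p) * (\<Prod>i\<in>T. A (f i) (f (p i)))"
      by (simp add: sign_map_permutation[OF inj p assms(2)])
  next
    fix q assume "q \<in> {q. q permutes S}"
    then have q: "q permutes S" by simp
    show "map_permutation T f (map_permutation S ?g q) = q" by (rule fg[OF q])
    show "map_permutation S ?g q \<in> {p. p permutes T}"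
      using map_permutation_permutes[OF g q] by simp
  qed
qed

lemma det_eq_pminor:
  assumes "A \<in> carrier_mat n n"
  shows "det A = pminor (\<lambda>i j. A $$ (i, j)) {..<n}"
  unfolding det_def'[OF assms] pminor_def by (simp add: atLeast0LessThan)

lemma bij_betw_pick:
  assumes "finite S"
  shows "bij_betw (pick S) {..<card S} S"
proof -
  have "inj_on (pick S) {..<card S}"
    by (intro linorder_inj_onI') (use pick_mono[of _ S] in force)
  moreover have "pick S ` {..<card S} \<subseteq> S" using pick_in_set[of _ S] by auto
  moreover have "pick S ` {..<card S} = S"
    using calculation assms by (intro card_subset_eq) (simp_all add: card_image)
  ultimately show ?thesis by (simp add: bij_betw_def)
qed

lemma principal_minor_eq_pminor:
  assumes "A \<in> carrier_mat n n" "S \<subseteq> {..<n}"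
  shows "principal_minor A S = pminor (\<lambda>i j. A $$ (i, j)) S"
proof -
  have fS: "finite S" using assms(2) finite_subset by blast
  have "{i. i < n \<and> i \<in> S} = S" using assms(2) by auto
  then have sub: "submatrix A S S = mat (card S) (card S) (\<lambda>(i, j). A $$ (pick S i, pick S j))"
    using assms(1) by (simp add: submatrix_def)
  have "principal_minor A S = pminor (\<lambda>i j. submatrix A S S $$ (i, j)) {..<card S}"
    unfolding principal_minor_def by (rule det_eq_pminor) (simp add: sub)
  also have "\<dots> = pminor (\<lambda>i j. A $$ (pick S i, pick S j)) {..<card S}"
    by (rule pminor_cong) (simp add: sub)
  also have "\<dots> = pminor (\<lambda>i j. A $$ (i, j)) S"
    by (rule pminor_bij_betw[OF bij_betw_pick[OF fS]]) simp
  finally show ?thesis .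
qed

section \<open>Minor sums as coefficients of determinants\<close>

text \<open>Multiplying out each product chooses the set S of positions that take the entry of A. A
  permutation contributes only if it fixes every index of V - S, that is, if it permutes S.\<close>

lemma pminor_add_diagonal:
  assumes "finite V"
  shows "pminor (\<lambda>i j. A i j + (if i = j then x else 0)) V = (\<Sum>S\<in>Pow V. x ^ card (V - S) * pminor A S)"
proof -
  let ?d = "\<lambda>p S. \<Prod>i\<in>V - S. if i = p i then x else 0"
  have "pminor (\<lambda>i j. A i j + (if i = j then x else 0)) V =
      (\<Sum>p | p permutes V. \<Sum>S\<in>Pow V. of_int (sign p) * ((\<Prod>i\<in>S. A i (p i)) * ?d p S))"
    unfolding pminor_def prod_add[OF assms] sum_distrib_left ..
  also have "\<dots> = (\<Sum>S\<in>Pow V. \<Sum>p | p permutes V. of_int (sign p) * ((\<Prod>i\<in>S. A i (p i)) * ?d p S))"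
    by (rule sum.swap)
  also have "\<dots> = (\<Sum>S\<in>Pow V. x ^ card (V - S) * pminor A S)"
  proof (intro sum.cong refl)
    fix S assume S: "S \<in> Pow V"
    have "(\<Sum>p | p permutes V. of_int (sign p) * ((\<Prod>i\<in>S. A i (p i)) * ?d p S)) =
        (\<Sum>p | p permutes S. of_int (sign p) * ((\<Prod>i\<in>S. A i (p i)) * ?d p S))"
    proof (rule sum.mono_neutral_right)
      show "finite {p. p permutes V}" by (rule finite_permutations[OF assms])
      show "{p. p permutes S} \<subseteq> {p. p permutes V}" using S permutes_subset by auto
      show "\<forall>p\<in>{p. p permutes V} - {p. p permutes S}. of_int (sign p) * ((\<Prod>i\<in>S. A i (p i)) * ?d p S) = 0"
      proof
        fix p assume p: "p \<in> {p. p permutes V} - {p. p permutes S}"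
        then obtain i where i: "i \<in> V - S" "p i \<noteq> i" using permutes_superset[of p V S] by auto
        then have "?d p S = 0" using assms by (intro prod_zero bexI[of _ i]) auto
        then show "of_int (sign p) * ((\<Prod>i\<in>S. A i (p i)) * ?d p S) = 0" by simp
      qed
    qed
    also have "\<dots> = (\<Sum>p | p permutes S. x ^ card (V - S) * (of_int (sign p) * (\<Prod>i\<in>S. A i (p i))))"
    proof (intro sum.cong refl)
      fix p assume "p \<in> {p. p permutes S}"
      then have "?d p S = (\<Prod>i\<in>V - S. x)" by (intro prod.cong refl) (auto simp: permutes_not_in)
      then show "of_int (sign p) * ((\<Prod>i\<in>S. A i (p i)) * ?d p S) =
          x ^ card (V - S) * (of_int (sign p) * (\<Prod>i\<in>S. A i (p i)))" by (simp add: ac_simps)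
    qed
    also have "\<dots> = x ^ card (V - S) * pminor A S" unfolding pminor_def sum_distrib_left ..
    finally show "(\<Sum>p | p permutes V. of_int (sign p) * ((\<Prod>i\<in>S. A i (p i)) * ?d p S)) =
        x ^ card (V - S) * pminor A S" .
  qed
  finally show ?thesis .
qed

lemma sum_Pow_level_sum:
  fixes f :: "'a set \<Rightarrow> 'b::comm_semiring_1"
  assumes "finite V"
  shows "(\<Sum>S\<in>Pow V. h (card S) * f S) = (\<Sum>k\<le>card V. h k * level_sum f V k)"
proof -
  have "(\<Sum>S\<in>Pow V. h (card S) * f S) = (\<Sum>k\<le>card V. \<Sum>S | S \<in> Pow V \<and> card S = k. h (card S) * f S)"
    by (rule sum.group[symmetric]) (use assms card_mono in auto)
  also have "\<dots> = (\<Sum>k\<le>card V. h k * level_sum f V k)"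
    unfolding level_sum_def sum_distrib_left by (intro sum.cong refl) auto
  finally show ?thesis .
qed

text \<open>Applied over the polynomial ring in two ways: with x the variable X, and with x = 1 to X
  times a matrix, which reverses the order of the coefficients.\<close>

lemma det_add_scalar:
  assumes "A \<in> carrier_mat n n"
  shows "det (x \<cdot>\<^sub>m 1\<^sub>m n + A) = (\<Sum>k\<le>n. x ^ (n - k) * level_sum (pminor (\<lambda>i j. A $$ (i, j))) {..<n} k)"
proof -
  have "det (x \<cdot>\<^sub>m 1\<^sub>m n + A) = pminor (\<lambda>i j. (x \<cdot>\<^sub>m 1\<^sub>m n + A) $$ (i, j)) {..<n}"
    using assms by (intro det_eq_pminor) auto
  also have "\<dots> = pminor (\<lambda>i j. A $$ (i, j) + (if i = j then x else 0)) {..<n}"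
    using assms by (intro pminor_cong) auto
  also have "\<dots> = (\<Sum>S\<in>Pow {..<n}. x ^ card ({..<n} - S) * pminor (\<lambda>i j. A $$ (i, j)) S)"
    by (rule pminor_add_diagonal) simp
  also have "\<dots> = (\<Sum>S\<in>Pow {..<n}. x ^ (n - card S) * pminor (\<lambda>i j. A $$ (i, j)) S)"
    by (intro sum.cong refl) (auto simp: card_Diff_subset finite_subset[OF _ finite_lessThan])
  also have "\<dots> = (\<Sum>k\<le>n. x ^ (n - k) * level_sum (pminor (\<lambda>i j. A $$ (i, j))) {..<n} k)"
    using sum_Pow_level_sum[of "{..<n}" "\<lambda>k. x ^ (n - k)"] by simp
  finally show ?thesis .
qed

lemma (in comm_ring_hom) pminor_hom: "pminor (\<lambda>i j. hom (A i j)) S = hom (pminor A S)"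
  unfolding pminor_def by (simp add: hom_distribs)

lemma pminor_scale:
  "pminor (\<lambda>i j. c * A i j) S = c ^ card S * pminor A S"
  unfolding pminor_def sum_distrib_left
  by (intro sum.cong refl) (simp add: prod.distrib ac_simps)

lemma pminor_const_poly: "pminor (\<lambda>i j. [:A i j:]) S = [:pminor A S:]"
proof -
  interpret comm_ring_hom "\<lambda>a. [:a:]" by unfold_locales auto
  show ?thesis by (rule pminor_hom)
qed

lemma level_sum_const_poly: "level_sum (\<lambda>S. [:f S:]) V k = [:level_sum f V k:]"
proof -
  interpret comm_monoid_add_hom "\<lambda>a. [:a:]" by unfold_locales auto
  show ?thesis unfolding level_sum_def by (simp add: hom_sum)
qed

lemma coeff_sum_decreasing_powers:
  assumes "m \<le> n"
  shows "coeff (\<Sum>k\<le>n. [:0, 1:] ^ (n - k) * [:e k:]) (n - m) = e m"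
proof -
  have "coeff (\<Sum>k\<le>n. [:0, 1:] ^ (n - k) * [:e k:]) (n - m) = (\<Sum>k\<le>n. coeff (monom (e k) (n - k)) (n - m))"
    by (simp add: coeff_sum monom_altdef)
  also have "\<dots> = (\<Sum>k\<le>n. if k = m then e k else 0)"
    using assms by (intro sum.cong refl) auto
  finally show ?thesis using assms by simp
qed

lemma coeff_sum_powers:
  assumes "m \<le> n"
  shows "coeff (\<Sum>k\<le>n. [:0, 1:] ^ k * [:e k:]) m = e m"
proof -
  have "coeff (\<Sum>k\<le>n. [:0, 1:] ^ k * [:e k:]) m = (\<Sum>k\<le>n. coeff (monom (e k) k) m)"
    by (simp add: coeff_sum monom_altdef)
  then show ?thesis using assms by simp
qed

abbreviation minor_sum :: "'a::comm_ring_1 mat \<Rightarrow> nat \<Rightarrow> 'a" where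
  "minor_sum A k \<equiv> level_sum (principal_minor A) {..<dim_row A} k"

lemma minor_sum_eq:
  assumes "A \<in> carrier_mat n n"
  shows "minor_sum A k = level_sum (pminor (\<lambda>i j. A $$ (i, j))) {..<n} k"
  unfolding level_sum_def using assms principal_minor_eq_pminor[OF assms] by (auto intro!: sum.cong)

lemma det_X_add:
  assumes "A \<in> carrier_mat n n"
  shows "det ([:0, 1:] \<cdot>\<^sub>m 1\<^sub>m n + map_mat (\<lambda>a. [:a:]) A) = (\<Sum>k\<le>n. [:0, 1:] ^ (n - k) * [:minor_sum A k:])"
proof -
  have "level_sum (pminor (\<lambda>i j. map_mat (\<lambda>a. [:a:]) A $$ (i, j))) {..<n} k = [:minor_sum A k:]" for k
  proof -
    have "level_sum (pminor (\<lambda>i j. map_mat (\<lambda>a. [:a:]) A $$ (i, j))) {..<n} k =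
        level_sum (\<lambda>S. [:pminor (\<lambda>i j. A $$ (i, j)) S:]) {..<n} k"
      unfolding level_sum_def pminor_const_poly[symmetric]
      using assms by (intro sum.cong refl pminor_cong) (auto simp: subset_iff)
    then show ?thesis by (simp add: level_sum_const_poly minor_sum_eq[OF assms])
  qed
  then show ?thesis using assms by (simp add: det_add_scalar[of _ n])
qed

lemma minor_sum_uminus:
  assumes "A \<in> carrier_mat n n"
  shows "minor_sum (- A) k = (- 1) ^ k * minor_sum A k"
proof -
  have "pminor (\<lambda>i j. (- A) $$ (i, j)) S = (- 1) ^ k * pminor (\<lambda>i j. A $$ (i, j)) S"
    if "S \<subseteq> {..<n}" "card S = k" for S
  proof -
    have "pminor (\<lambda>i j. (- A) $$ (i, j)) S = pminor (\<lambda>i j. - 1 * A $$ (i, j)) S"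
      using assms that by (intro pminor_cong) (auto simp: subset_iff)
    then show ?thesis unfolding pminor_scale that(2) .
  qed
  then show ?thesis
    unfolding minor_sum_eq[OF assms] minor_sum_eq[OF uminus_carrier_mat[OF assms]]
    unfolding level_sum_def sum_distrib_left by (intro sum.cong refl) auto
qed

text \<open>Up to the sign (- 1) ^ k, \<open>minor_sum M k\<close> is the coefficient of X ^ (n - k)
  in the characteristic polynomial, a similarity invariant.\<close>

lemma minor_sum_similar:
  fixes A B :: "'a::idom mat"
  assumes "similar_mat A B" "A \<in> carrier_mat n n" "B \<in> carrier_mat n n" "k \<le> n"
  shows "minor_sum A k = minor_sum B k"
proof -
  have coeff: "coeff (char_poly M) (n - k) = (- 1) ^ k * minor_sum M k" if M: "M \<in> carrier_mat n n"
    for M :: "'a mat"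
  proof -
    have "map_mat (\<lambda>a. [:- a:]) M = map_mat (\<lambda>a. [:a:]) (- M)" by (intro eq_matI) auto
    then have "char_poly M = (\<Sum>k\<le>n. [:0, 1:] ^ (n - k) * [:minor_sum (- M) k:])"
      using M det_X_add[of "- M" n] by (simp add: char_poly_defs)
    then show ?thesis using coeff_sum_decreasing_powers[OF assms(4)] minor_sum_uminus[OF M] by simp
  qed
  have "(- 1) ^ k * minor_sum A k = (- 1) ^ k * minor_sum B k"
    using char_poly_similar[OF assms(1)] coeff[OF assms(2)] coeff[OF assms(3)] by simp
  then show ?thesis by simp
qed

text \<open>From B C = I follows (X I + B) C = I + X C. Taking determinants and comparing the
  coefficients of X ^ m gives the reversal.\<close>

lemma minor_sum_inverse:
  assumes B: "B \<in> carrier_mat n n" and C: "C \<in> carrier_mat n n" and BC: "B * C = 1\<^sub>m n" and m: "m \<le> n"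
  shows "minor_sum C m = det C * minor_sum B (n - m)"
proof -
  let ?l = "map_mat (\<lambda>a. [:a:])" and ?X = "[:0, 1:]"
  interpret l: comm_ring_hom "\<lambda>a::'a. [:a:]" by unfold_locales auto
  have carr: "?l B \<in> carrier_mat n n" "?l C \<in> carrier_mat n n" using B C by auto
  \<comment> \<open>The identity keeps the form \<open>1 \<cdot>\<^sub>m 1\<^sub>m n\<close> so that
    \<open>det_add_scalar\<close> applies with x = 1.\<close>
  have prod: "(?X \<cdot>\<^sub>m 1\<^sub>m n + ?l B) * ?l C = 1 \<cdot>\<^sub>m 1\<^sub>m n + ?X \<cdot>\<^sub>m ?l C"
  proof -
    have "(?X \<cdot>\<^sub>m 1\<^sub>m n + ?l B) * ?l C = ?X \<cdot>\<^sub>m 1\<^sub>m n * ?l C + ?l B * ?l C"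
      using carr by (intro add_mult_distrib_mat) auto
    also have "?l B * ?l C = 1\<^sub>m n"
      using l.mat_hom_mult[OF B C] by (simp add: BC l.mat_hom_one)
    also have "?X \<cdot>\<^sub>m 1\<^sub>m n * ?l C = ?X \<cdot>\<^sub>m ?l C" using carr by auto
    also have "?X \<cdot>\<^sub>m ?l C + 1\<^sub>m n = 1 \<cdot>\<^sub>m 1\<^sub>m n + ?X \<cdot>\<^sub>m ?l C"
      using carr by (intro eq_matI) auto
    finally show ?thesis .
  qed
  have level: "level_sum (pminor (\<lambda>i j. (?X \<cdot>\<^sub>m ?l C) $$ (i, j))) {..<n} k = ?X ^ k * [:minor_sum C k:]" for k
  proof -
    have "pminor (\<lambda>i j. (?X \<cdot>\<^sub>m ?l C) $$ (i, j)) S = ?X ^ k * [:pminor (\<lambda>i j. C $$ (i, j)) S:]"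
      if "S \<subseteq> {..<n}" "card S = k" for S
    proof -
      have "pminor (\<lambda>i j. (?X \<cdot>\<^sub>m ?l C) $$ (i, j)) S = pminor (\<lambda>i j. ?X * [:C $$ (i, j):]) S"
        using C that by (intro pminor_cong) (auto simp: subset_iff)
      then show ?thesis unfolding pminor_scale that(2) pminor_const_poly .
    qed
    then have "level_sum (pminor (\<lambda>i j. (?X \<cdot>\<^sub>m ?l C) $$ (i, j))) {..<n} k =
        ?X ^ k * level_sum (\<lambda>S. [:pminor (\<lambda>i j. C $$ (i, j)) S:]) {..<n} k"
      unfolding level_sum_def sum_distrib_left by (intro sum.cong refl) auto
    then show ?thesis by (simp only: level_sum_const_poly minor_sum_eq[OF C])
  qed
  have "det (1 \<cdot>\<^sub>m 1\<^sub>m n + ?X \<cdot>\<^sub>m ?l C) = (\<Sum>k\<le>n. ?X ^ k * [:minor_sum C k:])"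
    by (simp only: det_add_scalar[OF smult_carrier_mat[OF carr(2)]] level power_one mult_1)
  then have "minor_sum C m = coeff (det (1 \<cdot>\<^sub>m 1\<^sub>m n + ?X \<cdot>\<^sub>m ?l C)) m"
    by (simp only: coeff_sum_powers[OF m])
  also have "det (1 \<cdot>\<^sub>m 1\<^sub>m n + ?X \<cdot>\<^sub>m ?l C) = det (?X \<cdot>\<^sub>m 1\<^sub>m n + ?l B) * det (?l C)"
    unfolding prod[symmetric] using carr by (intro det_mult) auto
  also have "det (?l C) = [:det C:]" by (rule l.hom_det)
  also have "coeff (det (?X \<cdot>\<^sub>m 1\<^sub>m n + ?l B) * [:det C:]) m = det C * minor_sum B (n - m)"
  proof -
    have "coeff (q * [:det C:]) m = det C * coeff q m" for q by simp
    moreover have "coeff (det (?X \<cdot>\<^sub>m 1\<^sub>m n + ?l B)) m = minor_sum B (n - m)"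
      unfolding det_X_add[OF B] using coeff_sum_decreasing_powers[of "n - m" n "minor_sum B"] m
      by (simp only: diff_diff_cancel diff_le_self)
    ultimately show ?thesis by simp
  qed
  finally show ?thesis .
qed

lemma minor_sum_of_real:
  assumes "B \<in> carrier_mat n n"
  shows "minor_sum (map_mat complex_of_real B) k = complex_of_real (minor_sum B k)"
proof -
  have carr: "map_mat complex_of_real B \<in> carrier_mat n n" using assms by simp
  have "minor_sum (map_mat complex_of_real B) k =
      level_sum (\<lambda>S. complex_of_real (pminor (\<lambda>i j. B $$ (i, j)) S)) {..<n} k"
    unfolding minor_sum_eq[OF carr] unfolding level_sum_def of_real_hom.pminor_hom[symmetric]
    using assms by (intro sum.cong refl pminor_cong) (auto simp: subset_iff)
  then show ?thesis unfolding minor_sum_eq[OF assms] by (simp add: level_sum_def)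
qed

section \<open>Newton's inequalities for M-matrices, inverse M-matrices and matrices similar to
  them\<close>

lemma newton_M_matrix:
  assumes "M_matrix B" "B \<in> carrier_mat n n" "1 \<le> j" "j < n"
  shows "real (j + 1) * real (n - j + 1) * (minor_sum B (j - 1) * minor_sum B (j + 1))
    \<le> real j * real (n - j) * (minor_sum B j)\<^sup>2"
proof -
  have "cycle_expansion {..<n} (pminor (\<lambda>i j. B $$ (i, j)))"
  proof (rule cycle_expansion_pminor)
    fix S :: "nat set" assume "S \<subseteq> {..<n}"
    then show "0 \<le> pminor (\<lambda>i j. B $$ (i, j)) S"
      using assms(1,2) principal_minor_eq_pminor[OF assms(2), of S] by (auto simp: M_matrix_def)
  qed (use assms(1,2) in \<open>auto simp: M_matrix_def\<close>)
  then show ?thesis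
    unfolding minor_sum_eq[OF assms(2)]
    using newton_level_sum[of "{..<n}" _ j] assms(3,4) by simp
qed

text \<open>The minor sums of the M-matrix C are those of B in reverse order times det C. The
  inequality for C at n - j has the coefficients of the one for B at j, and the positive factor (det
  C)^2 cancels from both sides.\<close>

lemma newton_inverse_M_matrix:
  assumes "inverse_M_matrix B" "B \<in> carrier_mat n n" "1 \<le> j" "j < n"
  shows "real (j + 1) * real (n - j + 1) * (minor_sum B (j - 1) * minor_sum B (j + 1))
    \<le> real j * real (n - j) * (minor_sum B j)\<^sup>2"
proof -
  obtain C where inv: "B * C = 1\<^sub>m n" "C * B = 1\<^sub>m (dim_row C)" and M: "M_matrix C"
    using assms(1,2) unfolding inverse_M_matrix_def inverts_mat_def by auto
  \<comment> \<open>\<open>inverts_mat\<close> does not fix the size of C; comparing the column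
    counts in both product equations does.\<close>
  have C: "C \<in> carrier_mat n n"
    using arg_cong[OF inv(1), of dim_col] arg_cong[OF inv(2), of dim_col] assms(2) by auto
  have "det B * det C = 1" using det_mult[OF assms(2) C] inv(1) by simp
  then have det: "det C \<noteq> 0" by auto
  note E = minor_sum_inverse[OF assms(2) C inv(1)]
  have "minor_sum C (n - j - 1) = det C * minor_sum B (j + 1)"
    "minor_sum C (n - j + 1) = det C * minor_sum B (j - 1)"
    "minor_sum C (n - j) = det C * minor_sum B j"
    using E[of "n - j - 1"] E[of "n - j + 1"] E[of "n - j"] assms(3,4) by simp_all
  moreover have "real (n - j + 1) * real (n - (n - j) + 1) * (minor_sum C (n - j - 1) * minor_sum C (n - j + 1))
      \<le> real (n - j) * real (n - (n - j)) * (minor_sum C (n - j))\<^sup>2"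
    using assms(3,4) by (intro newton_M_matrix[OF M C]) auto
  moreover have "n - (n - j) = j" using assms(4) by simp
  ultimately have "(det C)\<^sup>2 * (real (j + 1) * real (n - j + 1) * (minor_sum B (j - 1) * minor_sum B (j + 1)))
      \<le> (det C)\<^sup>2 * (real j * real (n - j) * (minor_sum B j)\<^sup>2)"
    by (simp only: power2_eq_square ac_simps)
  then show ?thesis using det by (subst (asm) mult_le_cancel_left_pos) auto
qed

text \<open>With N = n choose j, the product of the two neighbouring binomial coefficients is N^2 *
  j * (n - j) / ((j + 1) * (n - j + 1)), so the claim is the hypothesis divided by j * (n - j) *
  N^2.\<close>

lemma newton_normalize:
  fixes e :: "nat \<Rightarrow> real"
  assumes "1 \<le> j" "j < n"
    and "real (j + 1) * real (n - j + 1) * (e (j - 1) * e (j + 1)) \<le> real j * real (n - j) * (e j)\<^sup>2"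
  shows "e (j - 1) / real (n choose (j - 1)) * (e (j + 1) / real (n choose (j + 1))) \<le>
    (e j / real (n choose j))\<^sup>2"
proof -
  define N where "N = real (n choose j)"
  have N: "N > 0" using assms(2) by (simp add: N_def zero_less_binomial)
  have pos: "real j > 0" "real (n - j) > 0" "real (j + 1) > 0" "real (n - j + 1) > 0"
    using assms(1,2) by auto
  \<comment> \<open>The ratio of consecutive binomial coefficients, taken at k = j for the upper
    neighbour and at k = j - 1 for the lower one.\<close>
  have step: "Suc k * (n choose Suc k) = (n - k) * (n choose k)" for k
    using binomial_absorb_comp[of n k] binomial_absorption[of k n] by (cases n) auto
  have "Suc j * (n choose (j + 1)) = (n - j) * (n choose j)" using step[of j] by simp
  then have "real (j + 1) * real (n choose (j + 1)) = real (n - j) * N"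
    unfolding N_def by (metis Suc_eq_plus1 of_nat_mult)
  then have up: "real (n choose (j + 1)) = real (n - j) * N / real (j + 1)"
    using pos by (simp add: field_simps)
  have "j * (n choose j) = (n - j + 1) * (n choose (j - 1))" 
  proof -
    have "Suc (j - 1) = j" "n - (j - 1) = n - j + 1" using assms(1,2) by auto
    then show ?thesis using step[of "j - 1"] by simp
  qed
  then have "real j * N = real (n - j + 1) * real (n choose (j - 1))"
    unfolding N_def by (metis of_nat_mult)
  then have down: "real (n choose (j - 1)) = real j * N / real (n - j + 1)"
    using pos by (simp add: field_simps)
  have "e (j - 1) / real (n choose (j - 1)) * (e (j + 1) / real (n choose (j + 1))) =
      (real (j + 1) * real (n - j + 1) * (e (j - 1) * e (j + 1))) / (real j * real (n - j) * N\<^sup>2)"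
    unfolding up down by (simp add: power2_eq_square ac_simps)
  also have "\<dots> \<le> (real j * real (n - j) * (e j)\<^sup>2) / (real j * real (n - j) * N\<^sup>2)"
    using assms(3) by (rule divide_right_mono) auto
  also have "\<dots> = (e j / N)\<^sup>2" using pos by (simp add: power_divide)
  finally show ?thesis unfolding N_def .
qed

theorem theorem4:
  fixes n :: nat and A :: "complex mat"
  assumes "n \<ge> 1"
    and "A \<in> carrier_mat n n"
    and "\<exists>B :: real mat. (M_matrix B \<or> inverse_M_matrix B) \<and>
           similar_mat A (map_mat complex_of_real B)"
  shows "(\<forall>j\<le>n. normalized_coeff A j \<in> \<real>) \<and>
         (\<forall>j. 1 \<le> j \<and> j \<le> n - 1 \<longrightarrow>
            (Re (normalized_coeff A j))\<^sup>2
              \<ge> Re (normalized_coeff A (j - 1)) * Re (normalized_coeff A (j + 1)))"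
proof -
  obtain B where M: "M_matrix B \<or> inverse_M_matrix B"
    and sim: "similar_mat A (map_mat complex_of_real B)" using assms(3) by blast
  have BC: "map_mat complex_of_real B \<in> carrier_mat n n"
    using similar_matD[OF sim] assms(2) by auto
  then have B: "B \<in> carrier_mat n n" by simp
  \<comment> \<open>Similarity passes to the real matrix B, which yields the reality of the
    coefficients along with their values.\<close>
  have coeff: "normalized_coeff A k = complex_of_real (minor_sum B k / real (n choose k))" if "k \<le> n" for k
  proof -
    have "normalized_coeff A k = minor_sum A k / of_nat (n choose k)"
      using assms(2) by (simp add: normalized_coeff_def level_sum_def)
    then show ?thesis
      using minor_sum_similar[OF sim assms(2) BC that] minor_sum_of_real[OF B] by simp
  qed
  show ?thesis
  proof (intro conjI allI impI)
    show "normalized_coeff A j \<in> \<real>" if "j \<le> n" for j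
      unfolding coeff[OF that] by (rule Reals_of_real)
    fix j assume "1 \<le> j \<and> j \<le> n - 1"
    then have j: "1 \<le> j" "j < n" using assms(1) by auto
    have "real (j + 1) * real (n - j + 1) * (minor_sum B (j - 1) * minor_sum B (j + 1))
        \<le> real j * real (n - j) * (minor_sum B j)\<^sup>2"
      using M newton_M_matrix[OF _ B j] newton_inverse_M_matrix[OF _ B j] by blast
    from newton_normalize[OF j this]
    show "Re (normalized_coeff A (j - 1)) * Re (normalized_coeff A (j + 1)) \<le> (Re (normalized_coeff A j))\<^sup>2"
      using j coeff[of "j - 1"] coeff[of "j + 1"] coeff[of j] by simp
  qed
qed

end
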